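(* Let $(M,J,g)$ be an almost Kähler manifold and let $N$ be a submanifold of $M$, endowed with the Riemannian normalization $\nu N=T^{\perp_g}N$. Then the almost complex structure $J$ is soldered to $(N,T^{\perp_g}N)$ if and only if $N$ is a $J$-invariant, totally geodesic submanifold of $M$.
   Context: All manifolds, bundles, tensor fields, etc. are of class $C^\infty$; submanifolds are embedded. An almost Hermitian manifold $(M,J,g)$ is a Riemannian manifold $(M,g)$ with an almost complex structure $J$ that is $g$-skew-symmetric, i.e. $g(JV_1,V_2)=-g(V_1,JV_2)$. Its Kähler form is $\Omega(V_1,V_2)=g(JV_1,V_2)$. It is almost Kähler if $d\Omega=0$. ($J$ need not be integrable.) For a submanifold $N$ of $M$, the Riemannian normalization is the splitting $TM|_N=TN\oplus\nu N$ with $\nu N=T^{\perp_g}N$ the $g$-orthogonal bundle. A vector field $X$ on $M$ is normal to $N$ if $X|_N\in\Gamma(\nu N)$. For $x\in N$, $ann\,\nu_xN\subseteq T_x^*M$ is the annihilator of $\nu_xN$. A tensor field $A$ of type $(1,1)$ on $M$ (an endomorphism of $TM$, viewed as $A(Y,\xi)=\xi(AY)$) is soldered to $(N,\nu N)$ if for every vector field $X$ on $M$ that is normal to $N$ one has $(L_XA)_x(Y,\xi)=0$ for all $x\in N$, $Y\in T_xN$, $\xi\in ann\,\nu_xN$, where $L$ is the Lie derivative. $N$ is $J$-invariant if $J(TN)\subseteq TN$. $N$ is totally geodesic if its second fundamental form vanishes. *)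

theory Defs
  imports "HOL-Analysis.Analysis"
begin

section \<open>Smooth maps between Euclidean spaces\<close>

fun Ck_on :: "nat \<Rightarrow> 'e::euclidean_space set \<Rightarrow> ('e \<Rightarrow> 'f::real_normed_vector) \<Rightarrow> bool" where
  "Ck_on 0 S f \<longleftrightarrow> continuous_on S f"
| "Ck_on (Suc k) S f \<longleftrightarrow>
     (\<forall>x\<in>S. f differentiable (at x)) \<and> (\<forall>v. Ck_on k S (\<lambda>x. frechet_derivative f (at x) v))"

text \<open>Only meant for open \<open>S\<close>: the derivatives are taken in the ambient space.\<close>

definition smooth_on :: "'e::euclidean_space set \<Rightarrow> ('e \<Rightarrow> 'f::real_normed_vector) \<Rightarrow> bool" where
  "smooth_on S f \<longleftrightarrow> (\<forall>k. Ck_on k S f)"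


section \<open>Smooth manifolds\<close>

text \<open>
  The manifold is the whole type \<open>'a\<close>, which in the theorem is Hausdorff and second countable; it is
  modelled on a Euclidean space \<open>'e\<close>. A chart is a pair of its domain and its coordinate map; the
  values of the coordinate map outside the domain are irrelevant.
\<close>

type_synonym ('a, 'e) chart = "'a set \<times> ('a \<Rightarrow> 'e)"

definition chart_inv :: "('a, 'e) chart \<Rightarrow> 'e \<Rightarrow> 'a" where
  "chart_inv c = inv_into (fst c) (snd c)"

definition is_chart :: "('a::topological_space, 'e::euclidean_space) chart \<Rightarrow> bool" where
  "is_chart c \<longleftrightarrow> open (fst c) \<and> open (snd c ` fst c) \<and>
     homeomorphism (fst c) (snd c ` fst c) (snd c) (chart_inv c)"

definition compatible :: "('a, 'e::euclidean_space) chart \<Rightarrow> ('a, 'e) chart \<Rightarrow> bool" where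
  "compatible c d \<longleftrightarrow>
     smooth_on (snd c ` (fst c \<inter> fst d)) (snd d \<circ> chart_inv c) \<and>
     smooth_on (snd d ` (fst c \<inter> fst d)) (snd c \<circ> chart_inv d)"

text \<open>A smooth structure is a maximal smooth atlas.\<close>

definition smooth_structure ::
  "('a::topological_space, 'e::euclidean_space) chart set \<Rightarrow> bool" where
  "smooth_structure A \<longleftrightarrow>
     (\<forall>c\<in>A. is_chart c) \<and> (\<Union>c\<in>A. fst c) = UNIV \<and> (\<forall>c\<in>A. \<forall>d\<in>A. compatible c d) \<and>
     (\<forall>c. is_chart c \<and> (\<forall>d\<in>A. compatible c d) \<longrightarrow> c \<in> A)"


section \<open>Tangent vectors and differentials\<close>

text \<open>
  Every point has a preferred chart around it, and the tangent space at \<open>p\<close> is the model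
  space \<open>'e\<close>, a vector being represented by its components in the preferred chart at \<open>p\<close>. This is
  only a way of naming tangent vectors: neighbouring points may have unrelated preferred charts,
  and smoothness of tensor fields is always tested on components in one fixed chart.
\<close>

definition chart_at :: "('a, 'e) chart set \<Rightarrow> 'a \<Rightarrow> ('a, 'e) chart" where
  "chart_at A p = (SOME c. c \<in> A \<and> p \<in> fst c)"

definition differential ::
  "('a, 'e::euclidean_space) chart set \<Rightarrow> ('a \<Rightarrow> 'f::real_normed_vector) \<Rightarrow> 'a \<Rightarrow> 'e \<Rightarrow> 'f" where
  "differential A f p =
     frechet_derivative (f \<circ> chart_inv (chart_at A p)) (at (snd (chart_at A p) p))"

text \<open>
  The components in a chart \<open>c\<close> of a tangent vector \<open>v\<close> at \<open>p\<close> are \<open>differential A (snd c) p v\<close>.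
  Conversely, \<open>coord_vector A c p u\<close> is the tangent vector at \<open>p\<close> with components \<open>u\<close> in \<open>c\<close>.
\<close>

definition coord_vector ::
  "('a, 'e::euclidean_space) chart set \<Rightarrow> ('a, 'e) chart \<Rightarrow> 'a \<Rightarrow> 'e \<Rightarrow> 'e" where
  "coord_vector A c p = frechet_derivative (snd (chart_at A p) \<circ> chart_inv c) (at (snd c p))"


section \<open>Vector fields and tensor fields\<close>

definition vf_coords ::
  "('a, 'e::euclidean_space) chart set \<Rightarrow> ('a, 'e) chart \<Rightarrow> ('a \<Rightarrow> 'e) \<Rightarrow> 'e \<Rightarrow> 'e" where
  "vf_coords A c X y = differential A (snd c) (chart_inv c y) (X (chart_inv c y))"

definition vector_field :: "('a, 'e::euclidean_space) chart set \<Rightarrow> ('a \<Rightarrow> 'e) \<Rightarrow> bool" where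
  "vector_field A X \<longleftrightarrow> (\<forall>c\<in>A. smooth_on (snd c ` fst c) (vf_coords A c X))"

text \<open>Tensor fields of type (1,1), as fields of endomorphisms of the tangent spaces.\<close>

definition endomorphism_field ::
  "('a, 'e::euclidean_space) chart set \<Rightarrow> ('a \<Rightarrow> 'e \<Rightarrow> 'e) \<Rightarrow> bool" where
  "endomorphism_field A T \<longleftrightarrow> (\<forall>p. linear (T p)) \<and>
     (\<forall>c\<in>A. \<forall>u. smooth_on (snd c ` fst c)
        (\<lambda>y. let p = chart_inv c y in differential A (snd c) p (T p (coord_vector A c p u))))"

definition bilinear_form_field ::
  "('a, 'e::euclidean_space) chart set \<Rightarrow> ('a \<Rightarrow> 'e \<Rightarrow> 'e \<Rightarrow> real) \<Rightarrow> bool" where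
  "bilinear_form_field A b \<longleftrightarrow> (\<forall>p. bilinear (b p)) \<and>
     (\<forall>c\<in>A. \<forall>u v. smooth_on (snd c ` fst c)
        (\<lambda>y. let p = chart_inv c y in b p (coord_vector A c p u) (coord_vector A c p v)))"

definition deriv_along ::
  "('a, 'e::euclidean_space) chart set \<Rightarrow> ('a \<Rightarrow> 'e) \<Rightarrow> ('a \<Rightarrow> real) \<Rightarrow> 'a \<Rightarrow> real" where
  "deriv_along A X f p = differential A f p (X p)"

text \<open>
  The coordinate expression of the bracket in the preferred chart at \<open>p\<close>, in which the components of
  \<open>X p\<close> and \<open>Y p\<close> are \<open>X p\<close> and \<open>Y p\<close> themselves. The sign is the one for which the bracket is the
  commutator of derivations.
\<close>

definition lie_bracket ::
  "('a, 'e::euclidean_space) chart set \<Rightarrow> ('a \<Rightarrow> 'e) \<Rightarrow> ('a \<Rightarrow> 'e) \<Rightarrow> 'a \<Rightarrow> 'e" where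
  "lie_bracket A X Y p = (let c = chart_at A p; y = snd c p in
     frechet_derivative (vf_coords A c Y) (at y) (X p) -
     frechet_derivative (vf_coords A c X) (at y) (Y p))"

text \<open>
  \<open>(L\<^sub>X T)(Y) = [X, T Y] - T [X, Y]\<close>. As \<open>L\<^sub>X T\<close> is a tensor field, the value at \<open>p\<close> depends on the
  vector field \<open>Y\<close> only through \<open>Y p\<close>.
\<close>

definition lie_derivative ::
  "('a, 'e::euclidean_space) chart set \<Rightarrow> ('a \<Rightarrow> 'e) \<Rightarrow> ('a \<Rightarrow> 'e \<Rightarrow> 'e) \<Rightarrow> ('a \<Rightarrow> 'e) \<Rightarrow> 'a \<Rightarrow> 'e" where
  "lie_derivative A X T Y p =
     lie_bracket A X (\<lambda>q. T q (Y q)) p - T p (lie_bracket A X Y p)"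

definition exterior_derivative_2 ::
  "('a, 'e::euclidean_space) chart set \<Rightarrow> ('a \<Rightarrow> 'e \<Rightarrow> 'e \<Rightarrow> real) \<Rightarrow>
     ('a \<Rightarrow> 'e) \<Rightarrow> ('a \<Rightarrow> 'e) \<Rightarrow> ('a \<Rightarrow> 'e) \<Rightarrow> 'a \<Rightarrow> real" where
  "exterior_derivative_2 A \<omega> X Y Z p =
     deriv_along A X (\<lambda>q. \<omega> q (Y q) (Z q)) p
     - deriv_along A Y (\<lambda>q. \<omega> q (X q) (Z q)) p
     + deriv_along A Z (\<lambda>q. \<omega> q (X q) (Y q)) p
     - \<omega> p (lie_bracket A X Y p) (Z p)
     + \<omega> p (lie_bracket A X Z p) (Y p)
     - \<omega> p (lie_bracket A Y Z p) (X p)"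

definition closed_2_form ::
  "('a, 'e::euclidean_space) chart set \<Rightarrow> ('a \<Rightarrow> 'e \<Rightarrow> 'e \<Rightarrow> real) \<Rightarrow> bool" where
  "closed_2_form A \<omega> \<longleftrightarrow>
     (\<forall>X Y Z. vector_field A X \<and> vector_field A Y \<and> vector_field A Z \<longrightarrow>
        (\<forall>p. exterior_derivative_2 A \<omega> X Y Z p = 0))"


section \<open>Riemannian and almost Hermitian structures\<close>

definition riemannian_metric ::
  "('a, 'e::euclidean_space) chart set \<Rightarrow> ('a \<Rightarrow> 'e \<Rightarrow> 'e \<Rightarrow> real) \<Rightarrow> bool" where
  "riemannian_metric A g \<longleftrightarrow> bilinear_form_field A g \<and>
     (\<forall>p u v. g p u v = g p v u) \<and> (\<forall>p u. u \<noteq> 0 \<longrightarrow> g p u u > 0)"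

definition almost_complex_structure ::
  "('a, 'e::euclidean_space) chart set \<Rightarrow> ('a \<Rightarrow> 'e \<Rightarrow> 'e) \<Rightarrow> bool" where
  "almost_complex_structure A J \<longleftrightarrow> endomorphism_field A J \<and> (\<forall>p v. J p (J p v) = - v)"

definition almost_hermitian ::
  "('a, 'e::euclidean_space) chart set \<Rightarrow> ('a \<Rightarrow> 'e \<Rightarrow> 'e) \<Rightarrow> ('a \<Rightarrow> 'e \<Rightarrow> 'e \<Rightarrow> real) \<Rightarrow> bool" where
  "almost_hermitian A J g \<longleftrightarrow> riemannian_metric A g \<and> almost_complex_structure A J \<and>
     (\<forall>p u v. g p (J p u) v = - g p u (J p v))"

definition kahler_form ::
  "('a \<Rightarrow> 'e \<Rightarrow> 'e) \<Rightarrow> ('a \<Rightarrow> 'e \<Rightarrow> 'e \<Rightarrow> real) \<Rightarrow> 'a \<Rightarrow> 'e \<Rightarrow> 'e \<Rightarrow> real" where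
  "kahler_form J g p u v = g p (J p u) v"

definition almost_kahler ::
  "('a, 'e::euclidean_space) chart set \<Rightarrow> ('a \<Rightarrow> 'e \<Rightarrow> 'e) \<Rightarrow> ('a \<Rightarrow> 'e \<Rightarrow> 'e \<Rightarrow> real) \<Rightarrow> bool" where
  "almost_kahler A J g \<longleftrightarrow> almost_hermitian A J g \<and> closed_2_form A (kahler_form J g)"

definition koszul ::
  "('a, 'e::euclidean_space) chart set \<Rightarrow> ('a \<Rightarrow> 'e \<Rightarrow> 'e \<Rightarrow> real) \<Rightarrow>
     ('a \<Rightarrow> 'e) \<Rightarrow> ('a \<Rightarrow> 'e) \<Rightarrow> ('a \<Rightarrow> 'e) \<Rightarrow> 'a \<Rightarrow> real" where
  "koszul A g X Y Z p =
     deriv_along A X (\<lambda>q. g q (Y q) (Z q)) p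
     + deriv_along A Y (\<lambda>q. g q (X q) (Z q)) p
     - deriv_along A Z (\<lambda>q. g q (X q) (Y q)) p
     + g p (lie_bracket A X Y p) (Z p)
     - g p (lie_bracket A X Z p) (Y p)
     - g p (lie_bracket A Y Z p) (X p)"

text \<open>\<open>levi_civita A g X Y\<close> is the covariant derivative of \<open>Y\<close> along \<open>X\<close>, given by the Koszul formula.\<close>

definition levi_civita ::
  "('a, 'e::euclidean_space) chart set \<Rightarrow> ('a \<Rightarrow> 'e \<Rightarrow> 'e \<Rightarrow> real) \<Rightarrow>
     ('a \<Rightarrow> 'e) \<Rightarrow> ('a \<Rightarrow> 'e) \<Rightarrow> 'a \<Rightarrow> 'e" where
  "levi_civita A g X Y p =
     (THE w. \<forall>Z. vector_field A Z \<longrightarrow> 2 * g p w (Z p) = koszul A g X Y Z p)"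

text \<open>The defining property holds for every torsion-free metric connection.\<close>

lemma torsion_free_metric_imp_koszul:
  assumes g: "riemannian_metric A g"
    and torsion_free: "\<And>X Y p. vector_field A X \<Longrightarrow> vector_field A Y \<Longrightarrow>
      D X Y p - D Y X p = lie_bracket A X Y p"
    and metric: "\<And>X Y Z p. vector_field A X \<Longrightarrow> vector_field A Y \<Longrightarrow> vector_field A Z \<Longrightarrow>
      deriv_along A X (\<lambda>q. g q (Y q) (Z q)) p = g p (D X Y p) (Z p) + g p (Y p) (D X Z p)"
    and XYZ: "vector_field A X" "vector_field A Y" "vector_field A Z"
  shows "2 * g p (D X Y p) (Z p) = koszul A g X Y Z p"
proof -
  have bil: "bilinear (g p)" and sym: "g p u v = g p v u" for u v
    using g by (auto simp: riemannian_metric_def bilinear_form_field_def)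
  show ?thesis
    unfolding koszul_def
    using sym[of "Y p" "D X Z p"] sym[of "X p" "D Y Z p"] sym[of "X p" "D Z Y p"]
    by (simp add: metric[OF XYZ] metric[OF XYZ(2,1,3)] metric[OF XYZ(3,1,2)]
        torsion_free[OF XYZ(1,2), symmetric] torsion_free[OF XYZ(1,3), symmetric]
        torsion_free[OF XYZ(2,3), symmetric] bilinear_lsub[OF bil])
qed


section \<open>Submanifolds\<close>

text \<open>Embedded submanifolds, by slice charts; the charts may be taken from the maximal atlas.\<close>

definition embedded_submanifold ::
  "('a, 'e::euclidean_space) chart set \<Rightarrow> 'a set \<Rightarrow> bool" where
  "embedded_submanifold A N \<longleftrightarrow>
     (\<exists>k. \<forall>x\<in>N. \<exists>c\<in>A. x \<in> fst c \<and>
        (\<exists>S. subspace S \<and> dim S = k \<and> snd c ` (fst c \<inter> N) = snd c ` fst c \<inter> S))"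

text \<open>The velocities at \<open>x\<close> of the smooth curves in \<open>N\<close>.\<close>

definition tangent_space ::
  "('a, 'e::euclidean_space) chart set \<Rightarrow> 'a set \<Rightarrow> 'a \<Rightarrow> 'e set" where
  "tangent_space A N x = {v. \<exists>\<gamma> \<epsilon>. \<epsilon> > (0::real) \<and> \<gamma> 0 = x \<and>
     \<gamma> ` {-\<epsilon><..<\<epsilon>} \<subseteq> N \<inter> fst (chart_at A x) \<and>
     smooth_on {-\<epsilon><..<\<epsilon>} (snd (chart_at A x) \<circ> \<gamma>) \<and>
     ((snd (chart_at A x) \<circ> \<gamma>) has_vector_derivative v) (at 0)}"

definition normal_bundle ::
  "('a, 'e::euclidean_space) chart set \<Rightarrow> ('a \<Rightarrow> 'e \<Rightarrow> 'e \<Rightarrow> real) \<Rightarrow> 'a set \<Rightarrow> 'a \<Rightarrow> 'e set" where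
  "normal_bundle A g N x = {v. \<forall>w\<in>tangent_space A N x. g x v w = 0}"

definition annihilator :: "'e::real_vector set \<Rightarrow> ('e \<Rightarrow> real) set" where
  "annihilator V = {\<xi>. linear \<xi> \<and> (\<forall>v\<in>V. \<xi> v = 0)}"

text \<open>
  Soldering to a submanifold \<open>N\<close> with a normalization \<open>\<nu>\<close>. A vector in the tangent space of \<open>N\<close> at
  \<open>x\<close> is given as the value at \<open>x\<close> of a vector field \<open>Y\<close> on the manifold, on which nothing is
  required at other points.
\<close>

definition soldered ::
  "('a, 'e::euclidean_space) chart set \<Rightarrow> 'a set \<Rightarrow> ('a \<Rightarrow> 'e set) \<Rightarrow> ('a \<Rightarrow> 'e \<Rightarrow> 'e) \<Rightarrow> bool" where
  "soldered A N \<nu> T \<longleftrightarrow>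
     (\<forall>X. vector_field A X \<and> (\<forall>x\<in>N. X x \<in> \<nu> x) \<longrightarrow>
       (\<forall>x\<in>N. \<forall>Y. vector_field A Y \<and> Y x \<in> tangent_space A N x \<longrightarrow>
         (\<forall>\<xi>\<in>annihilator (\<nu> x). \<xi> (lie_derivative A X T Y x) = 0)))"

definition invariant_submanifold ::
  "('a, 'e::euclidean_space) chart set \<Rightarrow> ('a \<Rightarrow> 'e \<Rightarrow> 'e) \<Rightarrow> 'a set \<Rightarrow> bool" where
  "invariant_submanifold A J N \<longleftrightarrow>
     (\<forall>x\<in>N. J x ` tangent_space A N x \<subseteq> tangent_space A N x)"

definition normal_part ::
  "('a, 'e::euclidean_space) chart set \<Rightarrow> ('a \<Rightarrow> 'e \<Rightarrow> 'e \<Rightarrow> real) \<Rightarrow> 'a set \<Rightarrow> 'a \<Rightarrow> 'e \<Rightarrow> 'e" where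
  "normal_part A g N x v =
     (THE w. w \<in> normal_bundle A g N x \<and> v - w \<in> tangent_space A N x)"

text \<open>Here \<open>Y\<close> and \<open>Z\<close> are extensions to the ambient manifold of vector fields tangent to \<open>N\<close>.\<close>

definition second_fundamental_form ::
  "('a, 'e::euclidean_space) chart set \<Rightarrow> ('a \<Rightarrow> 'e \<Rightarrow> 'e \<Rightarrow> real) \<Rightarrow> 'a set \<Rightarrow>
     ('a \<Rightarrow> 'e) \<Rightarrow> ('a \<Rightarrow> 'e) \<Rightarrow> 'a \<Rightarrow> 'e" where
  "second_fundamental_form A g N Y Z x = normal_part A g N x (levi_civita A g Y Z x)"

definition totally_geodesic ::
  "('a, 'e::euclidean_space) chart set \<Rightarrow> ('a \<Rightarrow> 'e \<Rightarrow> 'e \<Rightarrow> real) \<Rightarrow> 'a set \<Rightarrow> bool" where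
  "totally_geodesic A g N \<longleftrightarrow>
     (\<forall>Y Z. vector_field A Y \<and> vector_field A Z \<and>
        (\<forall>x\<in>N. Y x \<in> tangent_space A N x \<and> Z x \<in> tangent_space A N x) \<longrightarrow>
        (\<forall>x\<in>N. second_fundamental_form A g N Y Z x = 0))"

end

theory Submission
  imports Defs "HOL-Real_Asymp.Real_Asymp"
begin

text \<open>
  If \<open>X\<close> is normal to \<open>N\<close> with \<open>X x = 0\<close> and derivative \<open>\<alpha> \<otimes> n\<close> at \<open>x\<close>, then for \<open>w\<close> tangent
  to \<open>N\<close> one has \<open>g ((L\<^sub>X J) w, w) = \<alpha>(w) g (J n, w)\<close>, so soldering makes \<open>J n\<close> normal and hence \<open>N\<close>
  \<open>J\<close>-invariant. If \<open>N\<close> is \<open>J\<close>-invariant and \<open>X\<close> is normal, then \<open>i\<^sub>X \<Omega>\<close> vanishes on \<open>TN\<close>, hence so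
  does \<open>L\<^sub>X \<Omega> = d i\<^sub>X \<Omega>\<close>. Expanding \<open>\<Omega> = g (J _, _)\<close> gives, for \<open>u\<close> and \<open>w\<close> tangent to \<open>N\<close> and \<open>II\<close> the
  second fundamental form,
  \<open>g ((L\<^sub>X J) u, w) = - (L\<^sub>X g)(J u, w) = 2 g (II (J u, w), X)\<close>,
  so that soldering is equivalent to \<open>II = 0\<close>.
\<close>

section \<open>Calculus of smooth maps\<close>

text \<open>All definitions quantify over global vector fields, so each pointwise claim needs a
  global field with a prescribed value, tangency or normality along \<open>N\<close>, or first
  derivative. Such fields come from cutoffs inside a single chart. Identities at \<open>x\<close>
  are computed in the preferred chart at \<open>x\<close>, where tangent vectors are their own
  components. There the Lie derivative of \<open>J\<close>, the differential of
  \<open>\<Omega>\<close> and the Koszul expression involve only first derivatives of components,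
  and the derivatives of auxiliary fields cancel. Two charts have to be compared to second order
  only for the tangency of brackets; this is what the symmetry of second derivatives is for. The
  link between the Lie derivative of \<open>g\<close> and \<open>II\<close> comes from
  differentiating \<open>g(Z, X) = 0\<close> along \<open>Y\<close> and \<open>g(Y, X) = 0\<close>
  along \<open>Z\<close>, for \<open>Y\<close>, \<open>Z\<close> tangent and \<open>X\<close>
  normal. Invariance has to precede geodesy: it makes \<open>J u\<close> run through all of
  \<open>TN\<close> as \<open>u\<close> does. The metric turns each tangent \<open>w\<close> into a
  covector \<open>g(_, w)\<close> annihilating the normal space, so soldering can be read as
  orthogonality to \<open>TN\<close>.\<close>

lemma frechet_derivative_eqI:
  "(f has_derivative f') (at x) \<Longrightarrow> frechet_derivative f (at x) = f'"
  by (rule frechet_derivative_at [symmetric])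

lemma frechet_derivative_cong_open:
  assumes "open S" "x \<in> S" "\<And>y. y \<in> S \<Longrightarrow> f y = g y"
  shows "frechet_derivative f (at x) = frechet_derivative g (at x)"
proof -
  have "(f has_derivative D) (at x) \<longleftrightarrow> (g has_derivative D) (at x)" for D
    using assms has_derivative_transform_within_open by metis
  then show ?thesis
    by (simp add: frechet_derivative_def)
qed

section \<open>Closure properties of maps of class C^k\<close>

lemma Ck_on_continuous: "Ck_on k S f \<Longrightarrow> continuous_on S f"
  by (cases k) (auto intro!: differentiable_imp_continuous_on differentiable_at_imp_differentiable_on)

lemma Ck_on_SucD: "Ck_on (Suc k) S f \<Longrightarrow> Ck_on k S f"
proof (induction k arbitrary: f)
  case 0
  then show ?case
    using Ck_on_continuous by (metis Ck_on.simps(1))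
next
  case (Suc k)
  then show ?case
    by (metis Ck_on.simps(2))
qed

text \<open>Derivatives are taken in the ambient space, so maps agreeing on an open set have equal
  derivatives on it; the induction passes the local model \<open>h\<close> on to its directional
  derivatives.\<close>

lemma Ck_on_local:
  assumes "\<And>x. x \<in> S \<Longrightarrow> \<exists>T h. open T \<and> x \<in> T \<and> Ck_on k T h \<and> (\<forall>y\<in>T. f y = h y)"
  shows "Ck_on k S f"
  using assms
proof (induction k arbitrary: f)
  case 0
  show ?case
    unfolding Ck_on.simps
  proof (rule continuous_at_imp_continuous_on, intro ballI)
    fix x assume "x \<in> S"
    then obtain T h where T: "open T" "x \<in> T" "continuous_on T h" "\<forall>y\<in>T. f y = h y"
      using 0[OF \<open>x \<in> S\<close>] by auto
    then show "isCont f x"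
      by (metis continuous_on_cong continuous_on_eq_continuous_at)
  qed
next
  case (Suc k)
  have "f differentiable (at x)" if "x \<in> S" for x
  proof -
    obtain T h where T: "open T" "x \<in> T" "Ck_on (Suc k) T h" "\<forall>y\<in>T. f y = h y"
      using Suc.prems[OF \<open>x \<in> S\<close>] by blast
    from T have "(h has_derivative frechet_derivative h (at x)) (at x)"
      using frechet_derivative_works by auto
    then have "(f has_derivative frechet_derivative h (at x)) (at x)"
      by (rule has_derivative_transform_within_open[OF _ T(1,2)]) (simp add: T(4))
    then show ?thesis
      by (auto simp: differentiable_def)
  qed
  moreover have "Ck_on k S (\<lambda>x. frechet_derivative f (at x) v)" for v
  proof (rule Suc.IH)
    fix x assume "x \<in> S"
    then obtain T h where T: "open T" "x \<in> T" "Ck_on (Suc k) T h" "\<forall>y\<in>T. f y = h y"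
      using Suc.prems[OF \<open>x \<in> S\<close>] by blast
    then have "\<forall>y\<in>T. frechet_derivative f (at y) v = frechet_derivative h (at y) v"
      using frechet_derivative_cong_open[of T _ f h] by auto
    then show "\<exists>T h. open T \<and> x \<in> T \<and> Ck_on k T h \<and> (\<forall>y\<in>T. frechet_derivative f (at y) v = h y)"
      using T(1,2) T(3)[unfolded Ck_on.simps] by blast
  qed
  ultimately show ?case
    by simp
qed

lemma Ck_on_cong:
  assumes "open S" "Ck_on k S h" "\<And>y. y \<in> S \<Longrightarrow> f y = h y"
  shows "Ck_on k S f"
  using assms by (intro Ck_on_local) auto

lemma Ck_on_subset: "Ck_on k S f \<Longrightarrow> T \<subseteq> S \<Longrightarrow> Ck_on k T f"
  by (induction k arbitrary: f) (auto intro: continuous_on_subset)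

lemma Ck_on_const: "Ck_on k S (\<lambda>x. c)"
  by (induction k arbitrary: c) (auto simp: frechet_derivative_const)

lemma Ck_on_bounded_linear:
  assumes "bounded_linear f" shows "Ck_on k S f"
proof (cases k)
  case 0
  then show ?thesis
    using assms by (simp add: linear_continuous_on)
next
  case (Suc n)
  have d: "(f has_derivative f) (at x)" for x
    using assms by (rule bounded_linear_imp_has_derivative)
  have fd: "frechet_derivative f (at x) = f" for x
    using d by (rule frechet_derivative_eqI)
  show ?thesis
    unfolding Suc Ck_on.simps fd
    using d by (auto simp: differentiable_def Ck_on_const)
qed

lemma Ck_on_linear_image:
  assumes "bounded_linear L" "open S" "Ck_on k S f"
  shows "Ck_on k S (\<lambda>x. L (f x))"
  using assms(3)
proof (induction k arbitrary: f)
  case 0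
  then show ?case
    using assms(1) by (simp add: bounded_linear.continuous_on)
next
  case (Suc k)
  have d: "((\<lambda>x. L (f x)) has_derivative (\<lambda>v. L (frechet_derivative f (at x) v))) (at x)" if "x \<in> S" for x
    using Suc.prems that bounded_linear.has_derivative[OF assms(1)]
    by (auto simp: frechet_derivative_works)
  have "Ck_on k S (\<lambda>x. L (frechet_derivative f (at x) v))" for v
    using Suc by auto
  then have "Ck_on k S (\<lambda>x. frechet_derivative (\<lambda>x. L (f x)) (at x) v)" for v
    by (rule Ck_on_cong[OF \<open>open S\<close>]) (simp add: frechet_derivative_eqI[OF d])
  with d show ?case
    by (auto simp: differentiable_def)
qed

lemma Ck_on_add:
  assumes "open S" "Ck_on k S f" "Ck_on k S g"
  shows "Ck_on k S (\<lambda>x. f x + g x)"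
  using assms(2,3)
proof (induction k arbitrary: f g)
  case 0
  then show ?case
    by (simp add: continuous_on_add)
next
  case (Suc k)
  have d: "((\<lambda>x. f x + g x) has_derivative
     (\<lambda>v. frechet_derivative f (at x) v + frechet_derivative g (at x) v)) (at x)" if "x \<in> S" for x
    using Suc.prems that by (auto intro!: has_derivative_add simp: frechet_derivative_works)
  have "Ck_on k S (\<lambda>x. frechet_derivative f (at x) v + frechet_derivative g (at x) v)" for v
    using Suc by auto
  then have "Ck_on k S (\<lambda>x. frechet_derivative (\<lambda>x. f x + g x) (at x) v)" for v
    by (rule Ck_on_cong[OF \<open>open S\<close>]) (simp add: frechet_derivative_eqI[OF d])
  with d show ?case
    by (auto simp: differentiable_def)
qed

lemma Ck_on_sum:
  assumes "open S" "\<And>i. i \<in> I \<Longrightarrow> Ck_on k S (f i)"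
  shows "Ck_on k S (\<lambda>x. \<Sum>i\<in>I. f i x)"
  using assms(2)
  by (induction I rule: infinite_finite_induct) (auto simp: Ck_on_const intro!: Ck_on_add \<open>open S\<close>)

lemma Ck_on_bounded_bilinear:
  assumes P: "bounded_bilinear P" and "open S" "Ck_on k S f" "Ck_on k S g"
  shows "Ck_on k S (\<lambda>x. P (f x) (g x))"
  using assms(3,4)
proof (induction k arbitrary: f g)
  case 0
  then show ?case
    by (simp add: bounded_bilinear.continuous_on[OF P])
next
  case (Suc k)
  have d: "((\<lambda>x. P (f x) (g x)) has_derivative
     (\<lambda>v. P (f x) (frechet_derivative g (at x) v) + P (frechet_derivative f (at x) v) (g x))) (at x)"
    if "x \<in> S" for x
    using Suc.prems that
    by (auto intro!: bounded_bilinear.FDERIV[OF P] simp: frechet_derivative_works)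
  have "Ck_on k S (\<lambda>x. P (f x) (frechet_derivative g (at x) v) + P (frechet_derivative f (at x) v) (g x))" for v
  proof (rule Ck_on_add[OF \<open>open S\<close>])
    show "Ck_on k S (\<lambda>x. P (f x) (frechet_derivative g (at x) v))"
      using Suc.prems by (intro Suc.IH) (auto dest: Ck_on_SucD simp del: Ck_on.simps, simp)
    show "Ck_on k S (\<lambda>x. P (frechet_derivative f (at x) v) (g x))"
      using Suc.prems by (intro Suc.IH) (simp, auto dest: Ck_on_SucD simp del: Ck_on.simps)
  qed
  then have "Ck_on k S (\<lambda>x. frechet_derivative (\<lambda>x. P (f x) (g x)) (at x) v)" for v
    by (rule Ck_on_cong[OF \<open>open S\<close>]) (simp add: frechet_derivative_eqI[OF d])
  with d show ?case
    by (auto simp: differentiable_def)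
qed

lemma Ck_on_compose:
  fixes g :: "'d::euclidean_space \<Rightarrow> 'e::euclidean_space" and f :: "'e \<Rightarrow> 'f::real_normed_vector"
  assumes "open S" "open T" "Ck_on k S g" "Ck_on k T f" "g ` S \<subseteq> T"
  shows "Ck_on k S (\<lambda>x. f (g x))"
  using assms(3,4)
proof (induction k arbitrary: f)
  case 0
  then show ?case
    using assms(5) continuous_on_compose2 by (metis Ck_on.simps(1))
next
  case (Suc k)
  have dg: "(g has_derivative frechet_derivative g (at x)) (at x)" if "x \<in> S" for x
    using Suc.prems that by (auto simp: frechet_derivative_works)
  have df: "(f has_derivative frechet_derivative f (at y)) (at y)" if "y \<in> T" for y
    using Suc.prems that by (auto simp: frechet_derivative_works)
  have d: "((\<lambda>x. f (g x)) has_derivative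
     (\<lambda>v. frechet_derivative f (at (g x)) (frechet_derivative g (at x) v))) (at x)" if "x \<in> S" for x
    using diff_chain_at[OF dg df, of x] that assms(5) by (auto simp: o_def)
  \<comment> \<open>The direction in which \<open>f\<close> is differentiated varies with
    \<open>x\<close>, while \<open>Ck_on\<close> controls only fixed directions; expanding it in
    \<open>Basis\<close> reduces to those.\<close>
  have eq: "frechet_derivative f (at (g x)) (frechet_derivative g (at x) v) =
      (\<Sum>b\<in>Basis. (frechet_derivative g (at x) v \<bullet> b) *\<^sub>R frechet_derivative f (at (g x)) b)"
    if "x \<in> S" for x v
  proof -
    have "linear (frechet_derivative f (at (g x)))"
      using df[of "g x"] that assms(5) by (auto intro: has_derivative_linear)
    then show ?thesis
      by (subst euclidean_representation[symmetric, of "frechet_derivative g (at x) v"])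
        (simp add: linear_sum linear_cmul)
  qed
  have "Ck_on k S (\<lambda>x. \<Sum>b\<in>Basis. (frechet_derivative g (at x) v \<bullet> b) *\<^sub>R frechet_derivative f (at (g x)) b)" for v
  proof (intro Ck_on_sum Ck_on_bounded_bilinear[OF bounded_bilinear_scaleR] \<open>open S\<close>)
    fix b :: 'e assume "b \<in> Basis"
    show "Ck_on k S (\<lambda>x. frechet_derivative g (at x) v \<bullet> b)"
      using Suc.prems by (intro Ck_on_linear_image[OF bounded_linear_inner_left] \<open>open S\<close>) auto
    show "Ck_on k S (\<lambda>x. frechet_derivative f (at (g x)) b)"
      using Suc.prems by (intro Suc.IH) (auto dest: Ck_on_SucD simp del: Ck_on.simps, simp)
  qed
  then have "Ck_on k S (\<lambda>x. frechet_derivative (\<lambda>x. f (g x)) (at x) v)" for v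
    by (rule Ck_on_cong[OF \<open>open S\<close>]) (simp add: frechet_derivative_eqI[OF d] eq)
  with d show ?case
    by (auto simp: differentiable_def)
qed

lemma Ck_on_inverse: "Ck_on k (- {0::real}) inverse"
proof (induction k)
  case 0
  show ?case
    by (auto intro!: continuous_intros)
next
  case (Suc k)
  have d: "(inverse has_derivative (\<lambda>v. - (inverse x * v * inverse x))) (at x)"
    if "x \<noteq> 0" for x :: real
    using that by (rule has_derivative_inverse')
  have o: "open (- {0::real})"
    by auto
  have "Ck_on k (- {0::real}) (\<lambda>x. - v * (inverse x * inverse x))" for v
    by (intro Ck_on_bounded_bilinear[OF bounded_bilinear_mult] o Suc Ck_on_const)
  then have "Ck_on k (- {0::real}) (\<lambda>x. frechet_derivative inverse (at x) v)" for v
    by (rule Ck_on_cong[OF o]) (simp add: frechet_derivative_eqI[OF d])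
  with d show ?case
    by (auto simp: differentiable_def)
qed

lemma smooth_on_Suc:
  "smooth_on S f \<longleftrightarrow> (\<forall>x\<in>S. f differentiable (at x)) \<and>
     (\<forall>v. smooth_on S (\<lambda>x. frechet_derivative f (at x) v))"
  unfolding smooth_on_def
  by (metis Ck_on.simps(2) Ck_on_SucD)

lemma smooth_on_differentiable: "smooth_on S f \<Longrightarrow> x \<in> S \<Longrightarrow> f differentiable (at x)"
  using smooth_on_Suc by blast

lemma smooth_on_has_derivative:
  "smooth_on S f \<Longrightarrow> x \<in> S \<Longrightarrow> (f has_derivative frechet_derivative f (at x)) (at x)"
  using smooth_on_differentiable frechet_derivative_works by blast

lemma smooth_on_frechet_derivative:
  "smooth_on S f \<Longrightarrow> smooth_on S (\<lambda>x. frechet_derivative f (at x) v)"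
  using smooth_on_Suc by blast

lemma smooth_on_local:
  assumes "\<And>x. x \<in> S \<Longrightarrow> \<exists>T h. open T \<and> x \<in> T \<and> smooth_on T h \<and> (\<forall>y\<in>T. f y = h y)"
  shows "smooth_on S f"
  using assms unfolding smooth_on_def by (metis Ck_on_local)

lemma smooth_on_cong:
  "open S \<Longrightarrow> smooth_on S h \<Longrightarrow> (\<And>y. y \<in> S \<Longrightarrow> f y = h y) \<Longrightarrow> smooth_on S f"
  unfolding smooth_on_def by (metis Ck_on_cong)

lemma smooth_on_subset: "smooth_on S f \<Longrightarrow> T \<subseteq> S \<Longrightarrow> smooth_on T f"
  unfolding smooth_on_def by (metis Ck_on_subset)

lemma smooth_on_const: "smooth_on S (\<lambda>x. c)"
  unfolding smooth_on_def by (metis Ck_on_const)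

lemma smooth_on_bounded_linear: "bounded_linear f \<Longrightarrow> smooth_on S f"
  unfolding smooth_on_def by (metis Ck_on_bounded_linear)

lemma smooth_on_linear_image:
  "bounded_linear L \<Longrightarrow> open S \<Longrightarrow> smooth_on S f \<Longrightarrow> smooth_on S (\<lambda>x. L (f x))"
  unfolding smooth_on_def by (metis Ck_on_linear_image)

lemma smooth_on_add:
  "open S \<Longrightarrow> smooth_on S f \<Longrightarrow> smooth_on S g \<Longrightarrow> smooth_on S (\<lambda>x. f x + g x)"
  unfolding smooth_on_def by (metis Ck_on_add)

lemma smooth_on_sum:
  "open S \<Longrightarrow> (\<And>i. i \<in> I \<Longrightarrow> smooth_on S (f i)) \<Longrightarrow> smooth_on S (\<lambda>x. \<Sum>i\<in>I. f i x)"
  unfolding smooth_on_def by (metis Ck_on_sum)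

lemma smooth_on_scaleR:
  "open S \<Longrightarrow> smooth_on S f \<Longrightarrow> smooth_on S g \<Longrightarrow> smooth_on S (\<lambda>x. f x *\<^sub>R g x)"
  unfolding smooth_on_def by (metis Ck_on_bounded_bilinear[OF bounded_bilinear_scaleR])

lemma smooth_on_diff:
  assumes "open S" "smooth_on S f" "smooth_on S g"
  shows "smooth_on S (\<lambda>x. f x - g x)"
  using smooth_on_add[OF assms(1,2) smooth_on_linear_image[OF bounded_linear_minus[OF bounded_linear_ident] assms(1,3)]]
  by simp

lemma smooth_on_inner:
  "open S \<Longrightarrow> smooth_on S f \<Longrightarrow> smooth_on S g \<Longrightarrow> smooth_on S (\<lambda>x. f x \<bullet> g x)"
  unfolding smooth_on_def by (metis Ck_on_bounded_bilinear[OF bounded_bilinear_inner])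

lemma smooth_on_compose:
  fixes g :: "'d::euclidean_space \<Rightarrow> 'e::euclidean_space" and f :: "'e \<Rightarrow> 'f::real_normed_vector"
  shows "open S \<Longrightarrow> open T \<Longrightarrow> smooth_on S g \<Longrightarrow> smooth_on T f \<Longrightarrow> g ` S \<subseteq> T \<Longrightarrow> smooth_on S (\<lambda>x. f (g x))"
  unfolding smooth_on_def by (metis Ck_on_compose)

lemma smooth_on_inverse:
  fixes f :: "'e::euclidean_space \<Rightarrow> real"
  assumes "open S" "smooth_on S f" "\<And>x. x \<in> S \<Longrightarrow> f x \<noteq> 0"
  shows "smooth_on S (\<lambda>x. inverse (f x))"
  using assms by (intro smooth_on_compose[of S "- {0}" f inverse]) (auto simp: smooth_on_def Ck_on_inverse)

section \<open>Smooth families of linear and bilinear maps\<close>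

lemma linear_euclidean_expand:
  fixes L :: "'e::euclidean_space \<Rightarrow> 'f::real_vector"
  assumes "linear L"
  shows "L u = (\<Sum>b\<in>Basis. (u \<bullet> b) *\<^sub>R L b)"
  by (subst euclidean_representation[symmetric, of u]) (simp add: linear_sum[OF assms] linear_cmul[OF assms])

text \<open>Tensor fields are declared smooth by testing on constant arguments. Expanding the
  argument in \<open>Basis\<close> extends this to arguments that vary smoothly.\<close>

lemma smooth_on_linear_family:
  fixes L :: "'d::euclidean_space \<Rightarrow> 'e::euclidean_space \<Rightarrow> 'f::real_normed_vector"
  assumes "open S" "\<And>y. y \<in> S \<Longrightarrow> linear (L y)"
    and "\<And>u. smooth_on S (\<lambda>y. L y u)" "smooth_on S U"
  shows "smooth_on S (\<lambda>y. L y (U y))"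
proof (rule smooth_on_cong[OF \<open>open S\<close>])
  show "smooth_on S (\<lambda>y. \<Sum>b\<in>Basis. (U y \<bullet> b) *\<^sub>R L y b)"
    by (intro smooth_on_sum smooth_on_scaleR smooth_on_inner smooth_on_const assms)
qed (use assms(2) linear_euclidean_expand in blast)

lemma smooth_on_bilinear_family:
  fixes B :: "'d::euclidean_space \<Rightarrow> 'e::euclidean_space \<Rightarrow> 'e \<Rightarrow> 'f::real_normed_vector"
  assumes "open S" "\<And>y. y \<in> S \<Longrightarrow> bilinear (B y)"
    and "\<And>u v. smooth_on S (\<lambda>y. B y u v)" "smooth_on S U" "smooth_on S V"
  shows "smooth_on S (\<lambda>y. B y (U y) (V y))"
proof (rule smooth_on_linear_family[OF assms(1) _ _ assms(4)])
  show "linear (\<lambda>u. B y u (V y))" if "y \<in> S" for y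
    using assms(2)[OF that] by (simp add: bilinear_def)
  show "smooth_on S (\<lambda>y. B y u (V y))" for u
    by (rule smooth_on_linear_family[OF assms(1) _ assms(3,5)]) (use assms(2) in \<open>simp add: bilinear_def\<close>)
qed

text \<open>Product rule for a matrix-valued map applied to a vector-valued one, with the first
  factor known only through its values on fixed vectors.\<close>

lemma has_derivative_linear_family:
  fixes L :: "'d::euclidean_space \<Rightarrow> 'e::euclidean_space \<Rightarrow> 'f::real_normed_vector"
  assumes "open S" "x \<in> S" "\<And>y. y \<in> S \<Longrightarrow> linear (L y)"
    and L: "\<And>u. (\<lambda>y. L y u) differentiable (at x)" and U: "(U has_derivative U') (at x)"
  shows "((\<lambda>y. L y (U y)) has_derivative
    (\<lambda>h. frechet_derivative (\<lambda>y. L y (U x)) (at x) h + L x (U' h))) (at x)"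
proof -
  define D where "D u = frechet_derivative (\<lambda>y. L y u) (at x)" for u
  have D: "((\<lambda>y. L y u) has_derivative D u) (at x)" for u
    unfolding D_def using L frechet_derivative_works by blast
  have exp: "L y u = (\<Sum>b\<in>Basis. (u \<bullet> b) *\<^sub>R L y b)" if "y \<in> S" for y u
    using assms(3)[OF that] by (rule linear_euclidean_expand)
  have "((\<lambda>y. \<Sum>b\<in>Basis. (u \<bullet> b) *\<^sub>R L y b) has_derivative (\<lambda>h. \<Sum>b\<in>Basis. (u \<bullet> b) *\<^sub>R D b h)) (at x)" for u
    by (auto intro!: derivative_eq_intros D)
  then have "((\<lambda>y. L y u) has_derivative (\<lambda>h. \<Sum>b\<in>Basis. (u \<bullet> b) *\<^sub>R D b h)) (at x)" for u
    by (rule has_derivative_transform_within_open[OF _ assms(1,2)]) (rule exp[symmetric])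
  \<comment> \<open>\<open>D\<close> inherits linearity in \<open>u\<close> from \<open>L\<close>;
    this collapses the basis sum below to \<open>D (U x) h\<close>.\<close>
  then have Deq: "D u h = (\<Sum>b\<in>Basis. (u \<bullet> b) *\<^sub>R D b h)" for u h
    unfolding D_def[of u] by (subst frechet_derivative_eqI) auto
  have "((\<lambda>y. \<Sum>b\<in>Basis. (U y \<bullet> b) *\<^sub>R L y b) has_derivative
      (\<lambda>h. \<Sum>b\<in>Basis. (U x \<bullet> b) *\<^sub>R D b h + (U' h \<bullet> b) *\<^sub>R L x b)) (at x)"
    by (auto intro!: derivative_eq_intros D U simp: algebra_simps)
  moreover have "(\<lambda>h. \<Sum>b\<in>Basis. (U x \<bullet> b) *\<^sub>R D b h + (U' h \<bullet> b) *\<^sub>R L x b) =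
      (\<lambda>h. D (U x) h + L x (U' h))"
    by (rule ext, simp add: sum.distrib, subst (2) Deq, subst exp[OF assms(2)], simp)
  ultimately have "((\<lambda>y. \<Sum>b\<in>Basis. (U y \<bullet> b) *\<^sub>R L y b) has_derivative
      (\<lambda>h. D (U x) h + L x (U' h))) (at x)"
    by simp
  then show ?thesis
    unfolding D_def by (rule has_derivative_transform_within_open[OF _ assms(1,2)]) (rule exp[symmetric])
qed

lemma has_derivative_bilinear_family:
  fixes B :: "'d::euclidean_space \<Rightarrow> 'e::euclidean_space \<Rightarrow> 'e \<Rightarrow> 'f::real_normed_vector"
  assumes S: "open S" "x \<in> S" and bil: "\<And>y. y \<in> S \<Longrightarrow> bilinear (B y)"
    and B: "\<And>u v. (\<lambda>y. B y u v) differentiable (at x)"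
    and U: "(U has_derivative U') (at x)" and V: "(V has_derivative V') (at x)"
  shows "((\<lambda>y. B y (U y) (V y)) has_derivative
    (\<lambda>h. frechet_derivative (\<lambda>y. B y (U x) (V x)) (at x) h + B x (U' h) (V x) + B x (U x) (V' h))) (at x)"
proof -
  have lin: "linear (\<lambda>u. B y u v)" "linear (B y u)" if "y \<in> S" for y u v
    using bil[OF that] by (auto simp: bilinear_def)
  have 1: "((\<lambda>y. B y u (V y)) has_derivative
    (\<lambda>h. frechet_derivative (\<lambda>y. B y u (V x)) (at x) h + B x u (V' h))) (at x)" for u
    by (rule has_derivative_linear_family[OF S lin(2) B V])
  have 2: "((\<lambda>y. B y (U y) (V y)) has_derivative
    (\<lambda>h. frechet_derivative (\<lambda>y. B y (U x) (V y)) (at x) h + B x (U' h) (V x))) (at x)"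
    using 1 by (intro has_derivative_linear_family[OF S _ _ U, where L = "\<lambda>y u. B y u (V y)"] lin(1))
      (auto simp: differentiable_def)
  show ?thesis
    using 2 unfolding frechet_derivative_eqI[OF 1] by (simp add: algebra_simps)
qed


section \<open>Smooth bump functions\<close>

text \<open>The powers of \<open>1/t\<close> are there for the induction: differentiating
  \<open>t^(-n) exp(-1/t)\<close> gives a combination of the same functions with exponents
  \<open>n + 1\<close> and \<open>n + 2\<close>. At \<open>0\<close> the exponential beats every
  power, for the values as well as for the difference quotients.\<close>

lemma Ck_on_flat: "Ck_on k UNIV (\<lambda>t::real. if t > 0 then inverse t ^ n * exp (- inverse t) else 0)"
proof (induction k arbitrary: n)
  case 0
  let ?f = "\<lambda>t::real. if t > 0 then inverse t ^ n * exp (- inverse t) else 0"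
  have "isCont ?f t" for t
  proof -
    consider "t > 0" | "t < 0" | "t = 0" by linarith
    then show ?thesis
    proof cases
      case 1
      then have "isCont (\<lambda>t. inverse t ^ n * exp (- inverse t)) t"
        by (intro continuous_intros) auto
      then show ?thesis
        using 1 eventually_nhds_in_open[of "{0<..}" t]
        by (subst isCont_cong) (auto elim: eventually_mono)
    next
      case 2
      have "isCont (\<lambda>t. 0) t" by simp
      then show ?thesis
        using 2 eventually_nhds_in_open[of "{..<0}" t]
        by (subst isCont_cong) (auto elim: eventually_mono)
    next
      case 3
      have "((\<lambda>t::real. inverse t ^ n * exp (- inverse t)) \<longlongrightarrow> 0) (at_right 0)"
        by real_asymp
      then have "(?f \<longlongrightarrow> 0) (at_right 0)"
        by (rule Lim_transform_eventually) (auto simp: eventually_at_filter)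
      moreover have "(?f \<longlongrightarrow> 0) (at_left 0)"
        by (rule Lim_transform_eventually[OF tendsto_const]) (auto simp: eventually_at_filter)
      ultimately show ?thesis
        unfolding 3 isCont_def by (simp add: filterlim_split_at)
    qed
  qed
  then show ?case
    by (simp add: continuous_at_imp_continuous_on)
next
  case (Suc k)
  let ?f = "\<lambda>n (t::real). if t > 0 then inverse t ^ n * exp (- inverse t) else 0"
  let ?f' = "\<lambda>t. ?f (n + 2) t - real n * ?f (n + 1) t"
  have d: "(?f n has_real_derivative ?f' t) (at t)" for t
  proof -
    consider "t > 0" | "t < 0" | "t = 0" by linarith
    then show ?thesis
    proof cases
      case 1
      have "((\<lambda>t. inverse t ^ n * exp (- inverse t)) has_real_derivative
        (real n * inverse t ^ (n - 1) * (- (inverse t * inverse t)) * exp (- inverse t)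
         + inverse t ^ n * (exp (- inverse t) * (inverse t * inverse t)))) (at t)"
        using 1 by (auto intro!: derivative_eq_intros)
      \<comment> \<open>For \<open>n = 0\<close> the exponent \<open>n - 1\<close> is truncated, but
        its coefficient \<open>real n\<close> is then zero.\<close>
      moreover have "real n * inverse t ^ (n - 1) * (- (inverse t * inverse t)) * exp (- inverse t)
         + inverse t ^ n * (exp (- inverse t) * (inverse t * inverse t)) = ?f' t"
        using 1 by (cases n) (auto simp: algebra_simps)
      ultimately have "((\<lambda>t. inverse t ^ n * exp (- inverse t)) has_real_derivative ?f' t) (at t)"
        by simp
      then show ?thesis
        by (rule has_field_derivative_transform_within_open[where S = "{0<..}"]) (use 1 in auto)
    next
      case 2
      have "((\<lambda>t::real. 0::real) has_real_derivative ?f' t) (at t)"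
        using 2 by simp
      then show ?thesis
        by (rule has_field_derivative_transform_within_open[where S = "{..<0}"]) (use 2 in auto)
    next
      case 3
      have "((\<lambda>t::real. inverse t ^ n * exp (- inverse t) / t) \<longlongrightarrow> 0) (at_right 0)"
        by real_asymp
      then have "((\<lambda>t. ?f n t / t) \<longlongrightarrow> 0) (at_right 0)"
        by (rule Lim_transform_eventually) (auto simp: eventually_at_filter)
      moreover have "((\<lambda>t. ?f n t / t) \<longlongrightarrow> 0) (at_left 0)"
        by (rule Lim_transform_eventually[OF tendsto_const]) (auto simp: eventually_at_filter)
      ultimately have "((\<lambda>t. ?f n t / t) \<longlongrightarrow> 0) (at 0)"
        by (simp add: filterlim_split_at)
      then show ?thesis
        unfolding 3 by (simp add: has_field_derivative_iff)
    qed
  qed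
  have "Ck_on k UNIV (\<lambda>t. v * (?f (n + 2) t + - real n * ?f (n + 1) t))" for v :: real
    by (intro Ck_on_bounded_bilinear[OF bounded_bilinear_mult] Ck_on_add Ck_on_const Suc open_UNIV)
  moreover have "frechet_derivative (?f n) (at t) v = v * (?f (n + 2) t + - real n * ?f (n + 1) t)" for t v
    using frechet_derivative_eqI[OF d[of t, unfolded has_field_derivative_def]] by (simp add: mult.commute)
  ultimately have "Ck_on k UNIV (\<lambda>t. frechet_derivative (?f n) (at t) v)" for v
    by presburger
  moreover have "\<forall>t\<in>UNIV. ?f n differentiable (at t)"
    using d unfolding differentiable_def has_field_derivative_def by blast
  ultimately show ?case
    unfolding Ck_on.simps by blast
qed

lemma smooth_bump:
  fixes y0 :: "'e::euclidean_space"
  assumes "r > 0"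
  obtains \<beta> :: "'e \<Rightarrow> real"
  where "smooth_on UNIV \<beta>" "\<beta> y0 = 1" "\<And>y. y \<notin> ball y0 r \<Longrightarrow> \<beta> y = 0"
proof -
  define f where "f = (\<lambda>t::real. if t > 0 then exp (- inverse t) else 0)"
  \<comment> \<open>The squared distance is used because it is smooth at \<open>y0\<close> too;
    \<open>f\<close> vanishes for nonpositive arguments, that is outside the ball of radius
    \<open>r\<close>.\<close>
  define \<alpha> where "\<alpha> = (\<lambda>y. f (r\<^sup>2 - (y - y0) \<bullet> (y - y0)))"
  define \<beta> where "\<beta> = (\<lambda>y. inverse (\<alpha> y0) *\<^sub>R \<alpha> y)"
  have f: "smooth_on UNIV f"
    using Ck_on_flat[of _ 0] by (simp add: smooth_on_def f_def cong: if_cong)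
  have id: "smooth_on UNIV (\<lambda>y::'e. y)"
    by (intro smooth_on_bounded_linear bounded_linear_ident)
  have \<alpha>: "smooth_on UNIV \<alpha>"
    unfolding \<alpha>_def
    by (rule smooth_on_compose[OF _ _ _ f])
      (auto intro!: smooth_on_diff smooth_on_inner smooth_on_const id)
  have pos: "\<alpha> y0 > 0"
    using assms by (simp add: \<alpha>_def f_def)
  have \<beta>: "smooth_on UNIV \<beta>"
    unfolding \<beta>_def by (intro smooth_on_scaleR smooth_on_const \<alpha> open_UNIV)
  show thesis
  proof
    show "smooth_on UNIV \<beta>" by fact
    show "\<beta> y0 = 1"
      using pos by (simp add: \<beta>_def)
    show "\<beta> y = 0" if "y \<notin> ball y0 r" for y
    proof -
      have "r\<^sup>2 \<le> (y - y0) \<bullet> (y - y0)"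
        using that assms by (simp add: dist_norm norm_minus_commute power2_norm_eq_inner[symmetric])
      then show ?thesis
        by (simp add: \<beta>_def \<alpha>_def f_def)
    qed
  qed
qed

text \<open>By two applications of the mean value theorem, the second difference of \<open>f\<close> over a small
  parallelogram is a value of the iterated derivative taken in either order.\<close>

lemma second_difference_mean_value:
  fixes f :: "'e::euclidean_space \<Rightarrow> real"
  assumes "smooth_on S f" "t > 0"
    and in_S: "\<And>a b. 0 \<le> a \<Longrightarrow> a \<le> t \<Longrightarrow> 0 \<le> b \<Longrightarrow> b \<le> t \<Longrightarrow> x + a *\<^sub>R u + b *\<^sub>R v \<in> S"
  obtains a b where "0 < a" "a < t" "0 < b" "b < t"
    "f (x + t *\<^sub>R u + t *\<^sub>R v) - f (x + t *\<^sub>R u) - f (x + t *\<^sub>R v) + f x =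
      t * t * frechet_derivative (\<lambda>y. frechet_derivative f (at y) u) (at (x + a *\<^sub>R u + b *\<^sub>R v)) v"
proof -
  let ?Df = "\<lambda>y. frechet_derivative f (at y)"
  let ?D2 = "\<lambda>y. frechet_derivative (\<lambda>y. ?Df y u) (at y)"
  have Df: "(f has_derivative ?Df y) (at y)" if "y \<in> S" for y
    using assms(1) that by (rule smooth_on_has_derivative)
  have D2: "((\<lambda>y. ?Df y u) has_derivative ?D2 y) (at y)" if "y \<in> S" for y
    using smooth_on_frechet_derivative[OF assms(1)] that by (rule smooth_on_has_derivative)
  define h where "h s = f (x + s *\<^sub>R u + t *\<^sub>R v) - f (x + s *\<^sub>R u)" for s
  have dh: "(h has_real_derivative (?Df (x + s *\<^sub>R u + t *\<^sub>R v) u - ?Df (x + s *\<^sub>R u) u)) (at s)"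
    if s: "0 \<le> s" "s \<le> t" for s
  proof -
    have in1: "x + s *\<^sub>R u + t *\<^sub>R v \<in> S" "x + s *\<^sub>R u \<in> S"
      using in_S[of s t] in_S[of s 0] s assms(2) by auto
    have "((\<lambda>s. x + s *\<^sub>R u + t *\<^sub>R v) has_derivative (\<lambda>r. r *\<^sub>R u)) (at s)"
      and "((\<lambda>s. x + s *\<^sub>R u) has_derivative (\<lambda>r. r *\<^sub>R u)) (at s)"
      by (auto intro!: derivative_eq_intros)
    from has_derivative_compose[OF this(1) Df[OF in1(1)]] has_derivative_compose[OF this(2) Df[OF in1(2)]]
    have "(h has_derivative (\<lambda>r. ?Df (x + s *\<^sub>R u + t *\<^sub>R v) (r *\<^sub>R u) - ?Df (x + s *\<^sub>R u) (r *\<^sub>R u))) (at s)"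
      unfolding h_def by (rule has_derivative_diff)
    moreover have "?Df y (r *\<^sub>R u) = ?Df y u * r" if "y \<in> S" for y r
      using linear_cmul[OF has_derivative_linear[OF Df[OF that]]] by simp
    ultimately show ?thesis
      unfolding has_field_derivative_def
      by (elim has_derivative_eq_rhs) (use in1 in \<open>simp add: fun_eq_iff left_diff_distrib\<close>)
  qed
  have "\<exists>a>0. a < t \<and> h t - h 0 = (t - 0) * (?Df (x + a *\<^sub>R u + t *\<^sub>R v) u - ?Df (x + a *\<^sub>R u) u)"
    by (rule MVT2[OF assms(2) dh])
  then obtain a where a: "0 < a" "a < t"
    "h t - h 0 = t * (?Df (x + a *\<^sub>R u + t *\<^sub>R v) u - ?Df (x + a *\<^sub>R u) u)"
    by auto
  define k where "k s = ?Df (x + a *\<^sub>R u + s *\<^sub>R v) u" for s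
  have dk: "(k has_real_derivative ?D2 (x + a *\<^sub>R u + s *\<^sub>R v) v) (at s)" if s: "0 \<le> s" "s \<le> t" for s
  proof -
    have in1: "x + a *\<^sub>R u + s *\<^sub>R v \<in> S"
      using in_S[of a s] s a by auto
    have "((\<lambda>s. x + a *\<^sub>R u + s *\<^sub>R v) has_derivative (\<lambda>r. r *\<^sub>R v)) (at s)"
      by (auto intro!: derivative_eq_intros)
    from has_derivative_compose[OF this D2[OF in1]]
    have "(k has_derivative (\<lambda>r. ?D2 (x + a *\<^sub>R u + s *\<^sub>R v) (r *\<^sub>R v))) (at s)"
      unfolding k_def .
    moreover have "?D2 (x + a *\<^sub>R u + s *\<^sub>R v) (r *\<^sub>R v) = ?D2 (x + a *\<^sub>R u + s *\<^sub>R v) v * r" for r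
      using linear_cmul[OF has_derivative_linear[OF D2[OF in1]]] by simp
    ultimately show ?thesis
      by (simp add: has_field_derivative_def)
  qed
  have "\<exists>b>0. b < t \<and> k t - k 0 = (t - 0) * ?D2 (x + a *\<^sub>R u + b *\<^sub>R v) v"
    by (rule MVT2[OF assms(2) dk])
  then obtain b where b: "0 < b" "b < t" "k t - k 0 = t * ?D2 (x + a *\<^sub>R u + b *\<^sub>R v) v"
    by auto
  have "f (x + t *\<^sub>R u + t *\<^sub>R v) - f (x + t *\<^sub>R u) - f (x + t *\<^sub>R v) + f x = h t - h 0"
    by (simp add: h_def)
  also have "\<dots> = t * (k t - k 0)"
    using a(3) by (simp add: k_def)
  finally show thesis
    using that a b by simp
qed

text \<open>The second difference over a parallelogram does not change when \<open>u\<close> and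
  \<open>v\<close> are exchanged. So \<open>P\<close> at one point near \<open>x\<close> equals
  \<open>Q\<close> at another, and continuity of both gives \<open>P x = Q x\<close>.\<close>

lemma symmetric_second_derivative_real:
  fixes f :: "'e::euclidean_space \<Rightarrow> real"
  assumes "open S" "smooth_on S f" "x \<in> S"
  shows "frechet_derivative (\<lambda>y. frechet_derivative f (at y) u) (at x) v =
    frechet_derivative (\<lambda>y. frechet_derivative f (at y) v) (at x) u"
proof -
  define P where "P = (\<lambda>y. frechet_derivative (\<lambda>y. frechet_derivative f (at y) u) (at y) v)"
  define Q where "Q = (\<lambda>y. frechet_derivative (\<lambda>y. frechet_derivative f (at y) v) (at y) u)"
  have "smooth_on S P" "smooth_on S Q"
    unfolding P_def Q_def by (intro smooth_on_frechet_derivative assms)+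
  then have "isCont P x" "isCont Q x"
    using smooth_on_differentiable[OF _ assms(3)] differentiable_imp_continuous_within by blast+
  have "dist (P x) (Q x) \<le> e" if "e > 0" for e
  proof -
    obtain d where d: "d > 0" "ball x d \<subseteq> S"
      "\<And>y. dist y x < d \<Longrightarrow> dist (P y) (P x) < e / 2" "\<And>y. dist y x < d \<Longrightarrow> dist (Q y) (Q x) < e / 2"
    proof -
      obtain d1 where "d1 > 0" "ball x d1 \<subseteq> S"
        using assms openE by blast
      moreover obtain d2 where "d2 > 0" "\<forall>y. dist y x < d2 \<longrightarrow> dist (P y) (P x) < e / 2"
        using \<open>isCont P x\<close>[unfolded continuous_at_eps_delta] \<open>e > 0\<close> half_gt_zero by metis
      moreover obtain d3 where "d3 > 0" "\<forall>y. dist y x < d3 \<longrightarrow> dist (Q y) (Q x) < e / 2"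
        using \<open>isCont Q x\<close>[unfolded continuous_at_eps_delta] \<open>e > 0\<close> half_gt_zero by metis
      ultimately show thesis
        by (intro that[of "min d1 (min d2 d3)"]) auto
    qed
    \<comment> \<open>With this side length all points of the parallelogram stay within distance
      \<open>d\<close> of \<open>x\<close>; the summand \<open>1\<close> keeps the denominator
      positive when \<open>u\<close> and \<open>v\<close> vanish.\<close>
    define t where "t = d / (2 * (norm u + norm v + 1))"
    have t: "t > 0"
      using d(1) by (simp add: t_def add_nonneg_pos)
    have near: "dist (x + a *\<^sub>R u + b *\<^sub>R v) x < d" if "0 \<le> a" "a \<le> t" "0 \<le> b" "b \<le> t" for a b
    proof -
      have "dist (x + a *\<^sub>R u + b *\<^sub>R v) x = norm (a *\<^sub>R u + b *\<^sub>R v)"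
        by (simp add: dist_norm)
      also have "\<dots> \<le> a * norm u + b * norm v"
        using norm_triangle_ineq[of "a *\<^sub>R u" "b *\<^sub>R v"] that by simp
      also have "\<dots> \<le> t * norm u + t * norm v"
        using that by (intro add_mono mult_right_mono) auto
      also have "\<dots> < 2 * (t * (norm u + norm v + 1))"
      proof -
        have "0 \<le> t * norm u" "0 \<le> t * norm v"
          using t by auto
        then show ?thesis
          using t unfolding distrib_left by linarith
      qed
      also have "\<dots> = d"
      proof -
        have "2 * (d / (2 * c) * c) = d" if "c > 0" for c :: real
          using that by simp
        then show ?thesis
          unfolding t_def by (simp only: add_nonneg_pos norm_ge_zero add_nonneg_nonneg zero_less_one)
      qed
      finally show ?thesis .
    qed
    then have in_S: "x + a *\<^sub>R u + b *\<^sub>R v \<in> S" "x + b *\<^sub>R v + a *\<^sub>R u \<in> S"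
      if "0 \<le> a" "a \<le> t" "0 \<le> b" "b \<le> t" for a b
      using that d(2) near[OF that] by (auto simp: dist_commute add_ac subset_iff)
    obtain a b where ab: "0 < a" "a < t" "0 < b" "b < t"
      "f (x + t *\<^sub>R u + t *\<^sub>R v) - f (x + t *\<^sub>R u) - f (x + t *\<^sub>R v) + f x = t * t * P (x + a *\<^sub>R u + b *\<^sub>R v)"
      unfolding P_def by (rule second_difference_mean_value[OF assms(2) t in_S(1)])
    obtain a' b' where ab': "0 < a'" "a' < t" "0 < b'" "b' < t"
      "f (x + t *\<^sub>R v + t *\<^sub>R u) - f (x + t *\<^sub>R v) - f (x + t *\<^sub>R u) + f x = t * t * Q (x + a' *\<^sub>R v + b' *\<^sub>R u)"
      unfolding Q_def by (rule second_difference_mean_value[OF assms(2) t in_S(2)])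
    have swap: "x + r *\<^sub>R v + s *\<^sub>R u = x + s *\<^sub>R u + r *\<^sub>R v" for r s
      by simp
    have "t * t * P (x + a *\<^sub>R u + b *\<^sub>R v) = t * t * Q (x + b' *\<^sub>R u + a' *\<^sub>R v)"
      using ab(5) ab'(5) unfolding swap by linarith
    then have "P (x + a *\<^sub>R u + b *\<^sub>R v) = Q (x + b' *\<^sub>R u + a' *\<^sub>R v)"
      using t by simp
    moreover have "dist (P (x + a *\<^sub>R u + b *\<^sub>R v)) (P x) < e / 2" "dist (Q (x + b' *\<^sub>R u + a' *\<^sub>R v)) (Q x) < e / 2"
      using d(3,4) near ab ab' by auto
    ultimately show ?thesis
      unfolding dist_real_def by linarith
  qed
  then have "P x = Q x"
    using field_le_epsilon[of "dist (P x) (Q x)" 0] by simp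
  then show ?thesis
    by (simp add: P_def Q_def)
qed

lemma symmetric_second_derivative:
  fixes f :: "'e::euclidean_space \<Rightarrow> 'f::euclidean_space"
  assumes "open S" "smooth_on S f" "x \<in> S"
  shows "frechet_derivative (\<lambda>y. frechet_derivative f (at y) u) (at x) v =
    frechet_derivative (\<lambda>y. frechet_derivative f (at y) v) (at x) u"
proof (rule euclidean_eqI)
  fix b :: 'f assume "b \<in> Basis"
  have inner: "frechet_derivative (\<lambda>y. h y \<bullet> b) (at y) w = frechet_derivative h (at y) w \<bullet> b"
    if "smooth_on S h" "y \<in> S" for h :: "'e \<Rightarrow> 'f" and y w
    using frechet_derivative_eqI[OF has_derivative_inner_left[OF smooth_on_has_derivative[OF that]], of b] by simp
  have "frechet_derivative (\<lambda>y. frechet_derivative f (at y) u) (at x) v \<bullet> b =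
      frechet_derivative (\<lambda>y. frechet_derivative (\<lambda>y. f y \<bullet> b) (at y) u) (at x) v" for u v
    using frechet_derivative_cong_open[OF assms(1,3), of "\<lambda>y. frechet_derivative (\<lambda>y. f y \<bullet> b) (at y) u"
       "\<lambda>y. frechet_derivative f (at y) u \<bullet> b"] inner[OF assms(2)]
      inner[OF smooth_on_frechet_derivative[OF assms(2)] assms(3)] by simp
  moreover have "smooth_on S (\<lambda>y. f y \<bullet> b)"
    by (intro smooth_on_inner smooth_on_const assms)
  ultimately show "frechet_derivative (\<lambda>y. frechet_derivative f (at y) u) (at x) v \<bullet> b =
      frechet_derivative (\<lambda>y. frechet_derivative f (at y) v) (at x) u \<bullet> b"
    using symmetric_second_derivative_real[OF assms(1) _ assms(3), of "\<lambda>y. f y \<bullet> b"] by simp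
qed

text \<open>Gram-Schmidt, with coefficients depending smoothly on \<open>y\<close>.\<close>

lemma smooth_orthogonalization:
  fixes G :: "'d::euclidean_space \<Rightarrow> 'e::euclidean_space \<Rightarrow> 'e \<Rightarrow> real"
  assumes "open V" and bil: "\<And>y. y \<in> V \<Longrightarrow> bilinear (G y)"
    and sym: "\<And>y u v. y \<in> V \<Longrightarrow> G y u v = G y v u"
    and pos: "\<And>y u. y \<in> V \<Longrightarrow> u \<noteq> 0 \<Longrightarrow> G y u u > 0"
    and G: "\<And>u v. smooth_on V (\<lambda>y. G y u v)"
    and "finite B" "independent B" and "smooth_on V F"
  shows "\<exists>F'. smooth_on V F' \<and> (\<forall>y\<in>V. F' y - F y \<in> span B \<and> (\<forall>b\<in>span B. G y (F' y) b = 0))"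
  using assms(6-8)
proof (induction B arbitrary: F rule: finite_induct)
  case empty
  then show ?case
    using bil by (intro exI[of _ F]) (auto simp: bilinear_rzero)
next
  case (insert b B)
  have indep: "independent B" "b \<notin> span B"
    using insert.prems(1) insert.hyps(2) by (auto simp: independent_insert)
  \<comment> \<open>The induction hypothesis is used for two maps: \<open>E\<close> makes the new
    vector \<open>b\<close> orthogonal to \<open>span B\<close>, and \<open>H\<close> does the same
    for \<open>F\<close>. Removing the \<open>E\<close>-component of \<open>H\<close> then keeps
    orthogonality to \<open>span B\<close> and adds orthogonality to \<open>E\<close>.\<close>
  obtain E where E: "smooth_on V E" "\<And>y. y \<in> V \<Longrightarrow> E y - b \<in> span B"
    "\<And>y v. y \<in> V \<Longrightarrow> v \<in> span B \<Longrightarrow> G y (E y) v = 0"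
    using insert.IH[OF indep(1) smooth_on_const[of V b]] by blast
  obtain H where H: "smooth_on V H" "\<And>y. y \<in> V \<Longrightarrow> H y - F y \<in> span B"
    "\<And>y v. y \<in> V \<Longrightarrow> v \<in> span B \<Longrightarrow> G y (H y) v = 0"
    using insert.IH[OF indep(1) insert.prems(2)] by blast
  \<comment> \<open>If \<open>E y\<close> vanished, \<open>b\<close> would lie in
    \<open>span B\<close>. This is where independence enters, and it makes the denominator of
    \<open>c\<close> nonzero.\<close>
  have E0: "E y \<noteq> 0" if "y \<in> V" for y
    using E(2)[OF that] indep(2) span_neg[of "- b" B] by auto
  define c where "c y = G y (H y) (E y) * inverse (G y (E y) (E y))" for y
  have "smooth_on V (\<lambda>y. G y (H y) (E y) *\<^sub>R inverse (G y (E y) (E y)))"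
  proof (intro smooth_on_scaleR smooth_on_inverse \<open>open V\<close>)
    show "smooth_on V (\<lambda>y. G y (H y) (E y))"
      by (rule smooth_on_bilinear_family[OF \<open>open V\<close> bil G H(1) E(1)])
    show "smooth_on V (\<lambda>y. G y (E y) (E y))"
      by (rule smooth_on_bilinear_family[OF \<open>open V\<close> bil G E(1) E(1)])
    show "G y (E y) (E y) \<noteq> 0" if "y \<in> V" for y
      using pos[OF that E0[OF that]] by simp
  qed
  then have c: "smooth_on V c"
    by (simp add: c_def[abs_def])
  have span: "span (insert b B) = {v. \<exists>k. v - k *\<^sub>R b \<in> span B}"
    by (rule span_insert)
  let ?F = "\<lambda>y. H y - c y *\<^sub>R E y"
  have "smooth_on V ?F"
    by (intro smooth_on_diff smooth_on_scaleR \<open>open V\<close> H(1) E(1) c)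
  moreover have "?F y - F y \<in> span (insert b B)" if "y \<in> V" for y
  proof -
    have "E y \<in> span (insert b B)"
      unfolding span using E(2)[OF that] by (auto intro!: exI[of _ 1])
    moreover have "H y - F y \<in> span (insert b B)"
      using H(2)[OF that] span_mono[of B "insert b B"] by auto
    ultimately have "(H y - F y) - c y *\<^sub>R E y \<in> span (insert b B)"
      using span_diff span_scale by blast
    then show ?thesis
      by (simp add: algebra_simps)
  qed
  moreover have "G y (?F y) v = 0" if "y \<in> V" "v \<in> span (insert b B)" for y v
  proof -
    note B = bil[OF that(1)]
    from that(2) obtain k where k: "v - k *\<^sub>R b \<in> span B"
      by (auto simp: span)
    \<comment> \<open>Replaces \<open>b\<close> by \<open>E y\<close> as the additional generator of
      \<open>span (insert b B)\<close>, since orthogonality is known for \<open>E y\<close> and not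
      for \<open>b\<close>.\<close>
    define w where "w = v - k *\<^sub>R E y"
    have "w = (v - k *\<^sub>R b) - k *\<^sub>R (E y - b)"
      by (simp add: w_def algebra_simps)
    then have w: "w \<in> span B"
      using k E(2)[OF that(1)] by (simp only: span_diff span_scale)
    have "G y (?F y) w = 0"
      using H(3)[OF that(1) w] E(3)[OF that(1) w] by (simp add: bilinear_lsub[OF B] bilinear_lmul[OF B])
    moreover have "G y (?F y) (E y) = 0"
      using pos[OF that(1) E0[OF that(1)]] by (simp add: bilinear_lsub[OF B] bilinear_lmul[OF B] c_def)
    moreover have "v = w + k *\<^sub>R E y"
      by (simp add: w_def)
    ultimately show ?thesis
      by (simp add: bilinear_radd[OF B] bilinear_rmul[OF B])
  qed
  ultimately show ?case
    by (intro exI[of _ ?F]) auto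
qed

section \<open>Charts and components\<close>

text \<open>For constant \<open>u\<close> and \<open>v\<close> these are the functions whose
  smoothness \<open>bilinear_form_field\<close> demands. Keeping \<open>u\<close> and
  \<open>v\<close> as arguments presents the form as a family of bilinear maps on the model space,
  to which the product rules apply.\<close>

definition form_coords ::
  "('a, 'e::euclidean_space) chart set \<Rightarrow> ('a, 'e) chart \<Rightarrow> ('a \<Rightarrow> 'e \<Rightarrow> 'e \<Rightarrow> real) \<Rightarrow>
     'e \<Rightarrow> 'e \<Rightarrow> 'e \<Rightarrow> real" where
  "form_coords A c b y u v =
     b (chart_inv c y) (coord_vector A c (chart_inv c y) u) (coord_vector A c (chart_inv c y) v)"

definition endo_coords ::
  "('a, 'e::euclidean_space) chart set \<Rightarrow> ('a, 'e) chart \<Rightarrow> ('a \<Rightarrow> 'e \<Rightarrow> 'e) \<Rightarrow> 'e \<Rightarrow> 'e \<Rightarrow> 'e" where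
  "endo_coords A c T y u =
     differential A (snd c) (chart_inv c y) (T (chart_inv c y) (coord_vector A c (chart_inv c y) u))"

text \<open>Derivatives at \<open>p\<close> of the components in the preferred chart at \<open>p\<close>; these are not tensorial.\<close>

definition vf_deriv :: "('a, 'e::euclidean_space) chart set \<Rightarrow> ('a \<Rightarrow> 'e) \<Rightarrow> 'a \<Rightarrow> 'e \<Rightarrow> 'e" where
  "vf_deriv A X p = frechet_derivative (vf_coords A (chart_at A p) X) (at (snd (chart_at A p) p))"

definition form_deriv ::
  "('a, 'e::euclidean_space) chart set \<Rightarrow> ('a \<Rightarrow> 'e \<Rightarrow> 'e \<Rightarrow> real) \<Rightarrow> 'a \<Rightarrow> 'e \<Rightarrow> 'e \<Rightarrow> 'e \<Rightarrow> real" where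
  "form_deriv A b p h u v =
     frechet_derivative (\<lambda>y. form_coords A (chart_at A p) b y u v) (at (snd (chart_at A p) p)) h"

definition endo_deriv ::
  "('a, 'e::euclidean_space) chart set \<Rightarrow> ('a \<Rightarrow> 'e \<Rightarrow> 'e) \<Rightarrow> 'a \<Rightarrow> 'e \<Rightarrow> 'e \<Rightarrow> 'e" where
  "endo_deriv A T p h u =
     frechet_derivative (\<lambda>y. endo_coords A (chart_at A p) T y u) (at (snd (chart_at A p) p)) h"

locale smooth_manifold =
  fixes A :: "('a::t2_space, 'e::euclidean_space) chart set"
  assumes atlas: "smooth_structure A"
begin

abbreviation comps :: "('a, 'e) chart \<Rightarrow> 'a \<Rightarrow> 'e \<Rightarrow> 'e" where
  "comps c \<equiv> differential A (snd c)"

abbreviation vec :: "('a, 'e) chart \<Rightarrow> 'a \<Rightarrow> 'e \<Rightarrow> 'e" where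
  "vec \<equiv> coord_vector A"

lemma is_chart: "c \<in> A \<Longrightarrow> is_chart c"
  and compatible: "c \<in> A \<Longrightarrow> d \<in> A \<Longrightarrow> compatible c d"
  using atlas unfolding smooth_structure_def by (elim conjE, blast)+

lemma open_domain: "c \<in> A \<Longrightarrow> open (fst c)"
  and open_range: "c \<in> A \<Longrightarrow> open (snd c ` fst c)"
  and chart_homeomorphism: "c \<in> A \<Longrightarrow> homeomorphism (fst c) (snd c ` fst c) (snd c) (chart_inv c)"
  using is_chart by (auto simp: is_chart_def)

lemma chart_inv_apply [simp]: "c \<in> A \<Longrightarrow> p \<in> fst c \<Longrightarrow> chart_inv c (snd c p) = p"
  by (rule homeomorphism_apply1[OF chart_homeomorphism])

lemma chart_at: "chart_at A p \<in> A" "p \<in> fst (chart_at A p)"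
proof -
  have "(\<Union>c\<in>A. fst c) = UNIV"
    using atlas unfolding smooth_structure_def by (elim conjE)
  then have "\<exists>c. c \<in> A \<and> p \<in> fst c"
    by blast
  from someI_ex[OF this] show "chart_at A p \<in> A" "p \<in> fst (chart_at A p)"
    unfolding chart_at_def by auto
qed

lemma open_chart_image:
  assumes "c \<in> A" "open U"
  shows "open (snd c ` (fst c \<inter> U))"
proof -
  have "snd c ` (fst c \<inter> U) = (snd c ` fst c) \<inter> chart_inv c -` U"
    using assms(1) by (auto intro!: rev_image_eqI)
  moreover have "continuous_on (snd c ` fst c) (chart_inv c)"
    using chart_homeomorphism[OF assms(1)] by (simp add: homeomorphism_def)
  ultimately show ?thesis
    using assms open_range by (auto intro: continuous_open_preimage)
qed

lemma transition_smooth: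
  "c \<in> A \<Longrightarrow> d \<in> A \<Longrightarrow> smooth_on (snd c ` (fst c \<inter> fst d)) (snd d \<circ> chart_inv c)"
  using compatible by (auto simp: compatible_def)

lemma transition_has_derivative:
  assumes "c \<in> A" "d \<in> A" "p \<in> fst c" "p \<in> fst d"
  shows "(snd d \<circ> chart_inv c has_derivative frechet_derivative (snd d \<circ> chart_inv c) (at (snd c p)))
    (at (snd c p))"
  by (rule smooth_on_has_derivative[OF transition_smooth]) (use assms in auto)

lemma linear_transition_derivative:
  "c \<in> A \<Longrightarrow> d \<in> A \<Longrightarrow> p \<in> fst c \<Longrightarrow> p \<in> fst d \<Longrightarrow>
    linear (frechet_derivative (snd d \<circ> chart_inv c) (at (snd c p)))"
  using transition_has_derivative by (blast intro: has_derivative_linear)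

text \<open>The cocycle rule, from the chain rule. Since \<open>comps\<close> and \<open>vec\<close>
  are transition derivatives from and to the preferred chart, it contains all changes of
  components.\<close>

lemma transition_derivative_compose:
  assumes A: "b \<in> A" "c \<in> A" "d \<in> A" and p: "p \<in> fst b" "p \<in> fst c" "p \<in> fst d"
  shows "frechet_derivative (snd d \<circ> chart_inv c) (at (snd c p))
      (frechet_derivative (snd c \<circ> chart_inv b) (at (snd b p)) u) =
    frechet_derivative (snd d \<circ> chart_inv b) (at (snd b p)) u"
proof -
  have "frechet_derivative (snd d \<circ> chart_inv b) (at (snd b p)) =
    frechet_derivative ((snd d \<circ> chart_inv c) \<circ> (snd c \<circ> chart_inv b)) (at (snd b p))"
    by (rule frechet_derivative_cong_open[OF open_chart_image[OF A(1) open_domain[OF A(2)]]])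
      (use A p in auto)
  also have "\<dots> = frechet_derivative (snd d \<circ> chart_inv c) (at (snd c p)) \<circ>
      frechet_derivative (snd c \<circ> chart_inv b) (at (snd b p))"
    using transition_has_derivative[of b c p] transition_has_derivative[of c d p] A p
    by (intro frechet_derivative_eqI diff_chain_at) auto
  finally show ?thesis
    by simp
qed

lemma transition_derivative_self:
  assumes "c \<in> A" "p \<in> fst c"
  shows "frechet_derivative (snd c \<circ> chart_inv c) (at (snd c p)) u = u"
proof -
  have "frechet_derivative (snd c \<circ> chart_inv c) (at (snd c p)) = frechet_derivative (\<lambda>y. y) (at (snd c p))"
    by (rule frechet_derivative_cong_open[OF open_range[OF assms(1)]]) (use assms in auto)
  then show ?thesis
    by simp
qed

context
  fixes c :: "('a, 'e) chart" and p :: 'a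
  assumes c: "c \<in> A" "p \<in> fst c"
begin

lemma linear_comps: "linear (comps c p)"
  unfolding differential_def by (rule linear_transition_derivative) (use c chart_at in auto)

lemma linear_vec: "linear (vec c p)"
  unfolding coord_vector_def by (rule linear_transition_derivative) (use c chart_at in auto)

lemma comps_vec [simp]: "comps c p (vec c p u) = u"
  using transition_derivative_compose[of c "chart_at A p" c p u] transition_derivative_self[of c p u]
    c chart_at by (simp add: differential_def coord_vector_def)

lemma vec_comps [simp]: "vec c p (comps c p u) = u"
  using transition_derivative_compose[of "chart_at A p" c "chart_at A p" p u]
    transition_derivative_self[of "chart_at A p" p u] c chart_at
  by (simp add: differential_def coord_vector_def)

lemma transition_comps:
  "d \<in> A \<Longrightarrow> p \<in> fst d \<Longrightarrow>
    frechet_derivative (snd d \<circ> chart_inv c) (at (snd c p)) (comps c p v) = comps d p v"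
  unfolding differential_def by (rule transition_derivative_compose) (use c chart_at in auto)

lemma vf_coords_apply: "vf_coords A c X (snd c p) = comps c p (X p)"
  using c by (simp add: vf_coords_def)

lemma form_coords_apply: "form_coords A c b (snd c p) (comps c p u) (comps c p v) = b p u v"
  using c by (simp add: form_coords_def)

lemma endo_coords_apply: "endo_coords A c T (snd c p) (comps c p u) = comps c p (T p u)"
  using c by (simp add: endo_coords_def)

end

lemma comps_chart_at [simp]: "comps (chart_at A p) p u = u"
  unfolding differential_def using transition_derivative_self chart_at by blast

lemma vec_chart_at [simp]: "vec (chart_at A p) p u = u"
  unfolding coord_vector_def using transition_derivative_self chart_at by blast

lemma vf_coords_chart_at [simp]: "vf_coords A (chart_at A p) X (snd (chart_at A p) p) = X p"
  using vf_coords_apply chart_at by simp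

lemma form_coords_chart_at [simp]:
  "form_coords A (chart_at A p) b (snd (chart_at A p) p) u v = b p u v"
  using chart_at by (simp add: form_coords_def)

lemma endo_coords_chart_at [simp]:
  "endo_coords A (chart_at A p) T (snd (chart_at A p) p) u = T p u"
  using chart_at by (simp add: endo_coords_def)

section \<open>Global vector fields built in one chart\<close>

text \<open>One chart around each point suffices: the components in any other chart are obtained by
  applying the transition derivative, a smooth family of linear maps, and composing with the
  transition map.\<close>

lemma vector_fieldI:
  assumes "\<And>p. \<exists>c W. c \<in> A \<and> p \<in> fst c \<and> open W \<and> snd c p \<in> W \<and> W \<subseteq> snd c ` fst c \<and>
    smooth_on W (vf_coords A c X)"
  shows "vector_field A X"
  unfolding vector_field_def
proof (intro ballI smooth_on_local)
  fix d y assume d: "d \<in> A" and "y \<in> snd d ` fst d"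
  then obtain p where p: "p \<in> fst d" "y = snd d p"
    by auto
  obtain c W where c: "c \<in> A" "p \<in> fst c" "open W" "snd c p \<in> W" "W \<subseteq> snd c ` fst c"
    "smooth_on W (vf_coords A c X)"
    using assms by blast
  let ?\<tau> = "snd c \<circ> chart_inv d"
  \<comment> \<open>\<open>V\<close> and \<open>U\<close> are the part of the overlap over
    \<open>W\<close>, seen in \<open>d\<close> and in \<open>c\<close>. The map \<open>h\<close>
    gives the \<open>d\<close>-components of \<open>X\<close> as a function of the
    \<open>c\<close>-coordinates.\<close>
  define V where "V = snd d ` (fst d \<inter> fst c) \<inter> ?\<tau> -` W"
  define U where "U = snd c ` (fst c \<inter> fst d) \<inter> W"
  define h where "h = (\<lambda>w. frechet_derivative (snd d \<circ> chart_inv c) (at w) (vf_coords A c X w))"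
  have opens: "open (snd d ` (fst d \<inter> fst c))" "open (snd c ` (fst c \<inter> fst d))"
    using open_chart_image open_domain c(1) d by auto
  have U: "open U"
    unfolding U_def using opens c(3) by blast
  have "continuous_on (snd d ` (fst d \<inter> fst c)) ?\<tau>"
    using transition_smooth[OF d c(1)] Ck_on_continuous unfolding smooth_on_def by blast
  then have V: "open V"
    unfolding V_def using continuous_open_preimage[OF _ opens(1) c(3)] by simp
  have "smooth_on U h"
    unfolding h_def
  proof (rule smooth_on_linear_family[OF U, where U = "vf_coords A c X"])
    show "linear (frechet_derivative (snd d \<circ> chart_inv c) (at y))" if "y \<in> U" for y
      using that linear_transition_derivative[OF c(1) d] by (auto simp: U_def)
    show "smooth_on U (\<lambda>y. frechet_derivative (snd d \<circ> chart_inv c) (at y) u)" for u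
      by (rule smooth_on_subset[OF smooth_on_frechet_derivative[OF transition_smooth[OF c(1) d]]])
        (auto simp: U_def)
    show "smooth_on U (vf_coords A c X)"
      using c(6) by (rule smooth_on_subset) (auto simp: U_def)
  qed
  moreover have "?\<tau> ` V \<subseteq> U"
    unfolding V_def U_def using c(1) d by auto
  moreover have "smooth_on V ?\<tau>"
    by (rule smooth_on_subset[OF transition_smooth[OF d c(1)]]) (auto simp: V_def)
  ultimately have "smooth_on V (\<lambda>z. h (?\<tau> z))"
    using smooth_on_compose[OF V U] by blast
  moreover have "vf_coords A d X z = h (?\<tau> z)" if "z \<in> V" for z
  proof -
    from that obtain q where q: "q \<in> fst d" "q \<in> fst c" "z = snd d q"
      by (auto simp: V_def)
    then show ?thesis
      using c(1) d by (simp add: h_def vf_coords_apply transition_comps)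
  qed
  moreover have "y \<in> V"
    using p c d by (auto simp: V_def)
  ultimately show "\<exists>T h. open T \<and> y \<in> T \<and> smooth_on T h \<and> (\<forall>y\<in>T. vf_coords A d X y = h y)"
    using V by (intro exI[of _ V] exI[of _ "\<lambda>z. h (?\<tau> z)"]) simp
qed

text \<open>The cutoff vanishes off a ball whose closure lies in the chart range. The image
  \<open>K\<close> of that closed ball is compact, hence closed in a Hausdorff space, so each point
  outside the chart domain has a neighbourhood on which the field is zero. \<open>\<beta>\<close> is
  chosen before \<open>F\<close>, so that whole families of fields can share one cutoff.\<close>

lemma vector_field_cutoff:
  assumes c: "c \<in> A" "x \<in> fst c"
  obtains \<beta> :: "'e \<Rightarrow> real" where "\<beta> (snd c x) = 1"
    "\<And>F. smooth_on (snd c ` fst c) F \<Longrightarrow>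
      vector_field A (\<lambda>p. if p \<in> fst c then \<beta> (snd c p) *\<^sub>R vec c p (F (snd c p)) else 0)"
proof -
  obtain r where r: "r > 0" "cball (snd c x) r \<subseteq> snd c ` fst c"
    using open_range[OF c(1)] c(2) open_contains_cball by blast
  obtain \<beta> :: "'e \<Rightarrow> real" where \<beta>: "smooth_on UNIV \<beta>" "\<beta> (snd c x) = 1"
    "\<And>y. y \<notin> ball (snd c x) r \<Longrightarrow> \<beta> y = 0"
    using smooth_bump[OF r(1), of "snd c x"] by blast
  define K where "K = chart_inv c ` cball (snd c x) r"
  have "continuous_on (cball (snd c x) r) (chart_inv c)"
    using chart_homeomorphism[OF c(1)] r(2) by (auto simp: homeomorphism_def intro: continuous_on_subset)
  then have "closed K"
    unfolding K_def by (intro compact_imp_closed compact_continuous_image) auto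
  have K: "K \<subseteq> fst c"
    using r(2) c(1) by (force simp: K_def)
  show thesis
  proof (rule that[of \<beta>])
    show "\<beta> (snd c x) = 1" by fact
    fix F :: "'e \<Rightarrow> 'e" assume F: "smooth_on (snd c ` fst c) F"
    let ?X = "\<lambda>p. if p \<in> fst c then \<beta> (snd c p) *\<^sub>R vec c p (F (snd c p)) else 0"
    show "vector_field A ?X"
    proof (rule vector_fieldI)
      fix p
      show "\<exists>d W. d \<in> A \<and> p \<in> fst d \<and> open W \<and> snd d p \<in> W \<and> W \<subseteq> snd d ` fst d \<and>
        smooth_on W (vf_coords A d ?X)"
      proof (cases "p \<in> fst c")
        case True
        have o: "open (snd c ` fst c)"
          using c by (simp add: open_range)
        have "smooth_on (snd c ` fst c) (\<lambda>y. \<beta> y *\<^sub>R F y)"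
          by (intro smooth_on_scaleR o F smooth_on_subset[OF \<beta>(1)]) auto
        then have "smooth_on (snd c ` fst c) (vf_coords A c ?X)"
          by (rule smooth_on_cong[OF o])
            (use c in \<open>auto simp: vf_coords_apply linear_cmul[OF linear_comps]\<close>)
        then show ?thesis
          using o c True by blast
      next
        case False
        let ?d = "chart_at A p"
        let ?W = "snd ?d ` (fst ?d \<inter> - K)"
        have o: "open ?W"
          using \<open>closed K\<close> chart_at by (intro open_chart_image) auto
        have "vf_coords A ?d ?X y = 0" if "y \<in> ?W" for y
        proof -
          from that obtain q where q: "q \<in> fst ?d" "q \<notin> K" "y = snd ?d q"
            by auto
          have "?X q = 0"
          proof (cases "q \<in> fst c")
            case True
            then have "snd c q \<notin> ball (snd c x) r"
              using q(2) c(1) imageI[of "snd c q" "cball (snd c x) r" "chart_inv c"] by (auto simp: K_def)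
            then show ?thesis
              using \<beta>(3) by simp
          qed simp
          then show ?thesis
            using q chart_at linear_0[OF linear_comps, of ?d q] by (simp add: vf_coords_apply)
        qed
        then have "smooth_on ?W (vf_coords A ?d ?X)"
          by (intro smooth_on_cong[OF o smooth_on_const])
        moreover have "snd ?d p \<in> ?W"
          using False K chart_at by auto
        ultimately show ?thesis
          using o chart_at by blast
      qed
    qed
  qed
qed

text \<open>Turns conditions stated for all vector fields into conditions on all tangent vectors at
  \<open>p\<close>.\<close>

lemma vector_field_through:
  obtains X where "vector_field A X" "X p = v"
proof -
  let ?c = "chart_at A p"
  obtain \<beta> where \<beta>: "\<beta> (snd ?c p) = 1"
    "\<And>F. smooth_on (snd ?c ` fst ?c) F \<Longrightarrow>
      vector_field A (\<lambda>p. if p \<in> fst ?c then \<beta> (snd ?c p) *\<^sub>R vec ?c p (F (snd ?c p)) else 0)"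
    using vector_field_cutoff[OF chart_at, of p] by blast
  show thesis
    by (rule that[OF \<beta>(2)[OF smooth_on_const[of _ v]]]) (simp add: \<beta>(1) chart_at)
qed

lemma vector_field_smooth: "vector_field A X \<Longrightarrow> c \<in> A \<Longrightarrow> smooth_on (snd c ` fst c) (vf_coords A c X)"
  by (simp add: vector_field_def)

section \<open>First derivatives of fields in the preferred chart\<close>

lemma vf_has_derivative:
  assumes "vector_field A X"
  shows "(vf_coords A (chart_at A p) X has_derivative vf_deriv A X p) (at (snd (chart_at A p) p))"
  unfolding vf_deriv_def
  by (rule smooth_on_has_derivative[OF vector_field_smooth[OF assms]]) (use chart_at in auto)

lemma lie_bracket_eq: "lie_bracket A X Y p = vf_deriv A Y p (X p) - vf_deriv A X p (Y p)"
  by (simp add: lie_bracket_def vf_deriv_def Let_def)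

lemma form_bilinear: "bilinear_form_field A b \<Longrightarrow> bilinear (b p)"
  by (simp add: bilinear_form_field_def)

lemma bilinear_form_coords:
  assumes "bilinear_form_field A b" "c \<in> A" "y \<in> snd c ` fst c"
  shows "bilinear (form_coords A c b y)"
proof -
  have "linear (vec c (chart_inv c y))"
    using assms by (intro linear_vec) auto
  then show ?thesis
    using form_bilinear[OF assms(1), of "chart_inv c y"]
    unfolding bilinear_def form_coords_def by (auto intro: linear_compose[unfolded o_def])
qed

lemma form_smooth:
  "bilinear_form_field A b \<Longrightarrow> c \<in> A \<Longrightarrow> smooth_on (snd c ` fst c) (\<lambda>y. form_coords A c b y u v)"
  by (simp add: bilinear_form_field_def form_coords_def Let_def)

lemma form_has_derivative:
  assumes b: "bilinear_form_field A b" and "vector_field A Y" "vector_field A Z"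
  shows "((\<lambda>y. form_coords A (chart_at A p) b y (vf_coords A (chart_at A p) Y y) (vf_coords A (chart_at A p) Z y))
    has_derivative (\<lambda>h. form_deriv A b p h (Y p) (Z p) + b p (vf_deriv A Y p h) (Z p) + b p (Y p) (vf_deriv A Z p h)))
    (at (snd (chart_at A p) p))"
proof -
  let ?c = "chart_at A p"
  have "((\<lambda>y. form_coords A ?c b y (vf_coords A ?c Y y) (vf_coords A ?c Z y)) has_derivative
    (\<lambda>h. frechet_derivative (\<lambda>y. form_coords A ?c b y (vf_coords A ?c Y (snd ?c p)) (vf_coords A ?c Z (snd ?c p))) (at (snd ?c p)) h
      + form_coords A ?c b (snd ?c p) (vf_deriv A Y p h) (vf_coords A ?c Z (snd ?c p))
      + form_coords A ?c b (snd ?c p) (vf_coords A ?c Y (snd ?c p)) (vf_deriv A Z p h))) (at (snd ?c p))"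
  proof (rule has_derivative_bilinear_family[OF open_range[OF chart_at(1)]])
    show "snd ?c p \<in> snd ?c ` fst ?c"
      using chart_at by auto
    then show "(\<lambda>y. form_coords A ?c b y u v) differentiable at (snd ?c p)" for u v
      using form_smooth[OF b chart_at(1)] smooth_on_differentiable by blast
  qed (use assms vf_has_derivative bilinear_form_coords chart_at in auto)
  then show ?thesis
    by (simp add: form_deriv_def)
qed

lemma deriv_along_form:
  assumes b: "bilinear_form_field A b" and Y: "vector_field A Y" and Z: "vector_field A Z"
  shows "deriv_along A X (\<lambda>q. b q (Y q) (Z q)) p =
    form_deriv A b p (X p) (Y p) (Z p) + b p (vf_deriv A Y p (X p)) (Z p) + b p (Y p) (vf_deriv A Z p (X p))"
proof -
  let ?c = "chart_at A p"
  have "frechet_derivative ((\<lambda>q. b q (Y q) (Z q)) \<circ> chart_inv ?c) (at (snd ?c p)) =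
    frechet_derivative (\<lambda>y. form_coords A ?c b y (vf_coords A ?c Y y) (vf_coords A ?c Z y)) (at (snd ?c p))"
    by (rule frechet_derivative_cong_open[OF open_range[OF chart_at(1)]])
      (use chart_at in \<open>auto simp: vf_coords_apply form_coords_apply\<close>)
  then show ?thesis
    unfolding deriv_along_def differential_def frechet_derivative_eqI[OF form_has_derivative[OF assms]]
    by simp
qed

lemma form_deriv_has_derivative:
  assumes "bilinear_form_field A b"
  shows "((\<lambda>y. form_coords A (chart_at A p) b y u v) has_derivative (\<lambda>h. form_deriv A b p h u v))
    (at (snd (chart_at A p) p))"
  unfolding form_deriv_def
  by (rule smooth_on_has_derivative[OF form_smooth[OF assms]]) (use chart_at in auto)

lemma linear_form_deriv: "bilinear_form_field A b \<Longrightarrow> linear (\<lambda>h. form_deriv A b p h u v)"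
  using form_deriv_has_derivative has_derivative_linear by blast

text \<open>Differentiates the pointwise linearity of the form and uses uniqueness of derivatives.
  Together with \<open>linear_form_deriv\<close> it makes the Koszul expression a linear functional
  of the last vector.\<close>

lemma linear_form_deriv_right:
  assumes b: "bilinear_form_field A b"
  shows "linear (form_deriv A b p h u)"
proof (rule linearI)
  let ?c = "chart_at A p"
  have bil: "bilinear (form_coords A ?c b y)" if "y \<in> snd ?c ` fst ?c" for y
    using bilinear_form_coords[OF b chart_at(1) that] .
  have p: "snd ?c p \<in> snd ?c ` fst ?c"
    using chart_at by blast
  fix v w :: 'e and r :: real
  have "((\<lambda>y. form_coords A ?c b y u (v + w)) has_derivative (\<lambda>h. form_deriv A b p h u v + form_deriv A b p h u w)) (at (snd ?c p))"
    by (rule has_derivative_transform_within_open[OF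
          has_derivative_add[OF form_deriv_has_derivative[OF b] form_deriv_has_derivative[OF b]]
          open_range[OF chart_at(1)] p]) (simp add: bilinear_radd[OF bil])
  from has_derivative_unique[OF form_deriv_has_derivative[OF b] this]
  show "form_deriv A b p h u (v + w) = form_deriv A b p h u v + form_deriv A b p h u w"
    by meson
  have "((\<lambda>y. form_coords A ?c b y u (r *\<^sub>R v)) has_derivative (\<lambda>h. r *\<^sub>R form_deriv A b p h u v)) (at (snd ?c p))"
    by (rule has_derivative_transform_within_open[OF
          has_derivative_scaleR_right[OF form_deriv_has_derivative[OF b]]
          open_range[OF chart_at(1)] p]) (simp add: bilinear_rmul[OF bil])
  from has_derivative_unique[OF form_deriv_has_derivative[OF b] this]
  show "form_deriv A b p h u (r *\<^sub>R v) = r *\<^sub>R form_deriv A b p h u v"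
    by meson
qed

lemma endo_linear: "endomorphism_field A T \<Longrightarrow> linear (T p)"
  by (simp add: endomorphism_field_def)

lemma linear_endo_coords:
  assumes "endomorphism_field A T" "c \<in> A" "y \<in> snd c ` fst c"
  shows "linear (endo_coords A c T y)"
proof -
  have "linear (vec c (chart_inv c y))" "linear (comps c (chart_inv c y))"
    using assms by (auto intro!: linear_vec linear_comps)
  from linear_compose[OF linear_compose[OF this(1) endo_linear[OF assms(1), of "chart_inv c y"]] this(2)]
  show ?thesis
    by (simp add: o_def endo_coords_def[abs_def])
qed

lemma endo_smooth:
  "endomorphism_field A T \<Longrightarrow> c \<in> A \<Longrightarrow> smooth_on (snd c ` fst c) (\<lambda>y. endo_coords A c T y u)"
  by (simp add: endomorphism_field_def endo_coords_def Let_def)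

lemma endo_deriv_has_derivative:
  assumes "endomorphism_field A T"
  shows "((\<lambda>y. endo_coords A (chart_at A p) T y u) has_derivative (\<lambda>h. endo_deriv A T p h u))
    (at (snd (chart_at A p) p))"
  unfolding endo_deriv_def
  by (rule smooth_on_has_derivative[OF endo_smooth[OF assms]]) (use chart_at in auto)

lemma vf_deriv_endo:
  assumes T: "endomorphism_field A T" and Y: "vector_field A Y"
  shows "vf_deriv A (\<lambda>q. T q (Y q)) p h = endo_deriv A T p h (Y p) + T p (vf_deriv A Y p h)"
proof -
  let ?c = "chart_at A p"
  have p: "snd ?c p \<in> snd ?c ` fst ?c"
    using chart_at by auto
  have "((\<lambda>y. endo_coords A ?c T y (vf_coords A ?c Y y)) has_derivative
    (\<lambda>h. frechet_derivative (\<lambda>y. endo_coords A ?c T y (vf_coords A ?c Y (snd ?c p))) (at (snd ?c p)) h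
      + endo_coords A ?c T (snd ?c p) (vf_deriv A Y p h))) (at (snd ?c p))"
  proof (rule has_derivative_linear_family[OF open_range[OF chart_at(1)] p _ _ vf_has_derivative[OF Y]])
    show "linear (endo_coords A ?c T y)" if "y \<in> snd ?c ` fst ?c" for y
      using linear_endo_coords[OF T chart_at(1) that] .
    show "(\<lambda>y. endo_coords A ?c T y u) differentiable at (snd ?c p)" for u
      using endo_deriv_has_derivative[OF T] unfolding differentiable_def by blast
  qed
  then have "((\<lambda>y. endo_coords A ?c T y (vf_coords A ?c Y y)) has_derivative
    (\<lambda>h. endo_deriv A T p h (Y p) + T p (vf_deriv A Y p h))) (at (snd ?c p))"
    by (simp add: endo_deriv_def)
  then have "(vf_coords A ?c (\<lambda>q. T q (Y q)) has_derivative
    (\<lambda>h. endo_deriv A T p h (Y p) + T p (vf_deriv A Y p h))) (at (snd ?c p))"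
    by (rule has_derivative_transform_within_open[OF _ open_range[OF chart_at(1)] p])
      (use chart_at in \<open>auto simp: vf_coords_apply endo_coords_apply\<close>)
  then show ?thesis
    unfolding vf_deriv_def by (simp add: frechet_derivative_eqI)
qed

text \<open>The term with the derivative of \<open>Y\<close> occurs both in \<open>[X, T Y]\<close>
  and in \<open>T [X, Y]\<close> and cancels. Hence only \<open>Y p\<close> matters, while
  \<open>X\<close> enters with its value and its derivative.\<close>

lemma lie_derivative_eq:
  assumes "endomorphism_field A T" "vector_field A X" "vector_field A Y"
  shows "lie_derivative A X T Y p =
    endo_deriv A T p (X p) (Y p) - vf_deriv A X p (T p (Y p)) + T p (vf_deriv A X p (Y p))"
  unfolding lie_derivative_def lie_bracket_eq vf_deriv_endo[OF assms(1,3)]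
  by (simp add: linear_diff[OF endo_linear[OF assms(1)]])

text \<open>The derivatives of the three fields cancel against the bracket terms by skewness, which
  leaves the alternating sum of derivatives of the coefficients.\<close>

lemma exterior_derivative_eq:
  assumes \<omega>: "bilinear_form_field A \<omega>" and skew: "\<And>u v. \<omega> p u v = - \<omega> p v u"
    and "vector_field A X" "vector_field A Y" "vector_field A Z"
  shows "exterior_derivative_2 A \<omega> X Y Z p =
    form_deriv A \<omega> p (X p) (Y p) (Z p) - form_deriv A \<omega> p (Y p) (X p) (Z p) + form_deriv A \<omega> p (Z p) (X p) (Y p)"
  using skew[of "Y p" "vf_deriv A Z p (X p)"] skew[of "X p" "vf_deriv A Z p (Y p)"] skew[of "X p" "vf_deriv A Y p (Z p)"]
  by (simp add: exterior_derivative_2_def deriv_along_form[OF \<omega>] assms(3-) lie_bracket_eq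
      bilinear_lsub[OF form_bilinear[OF \<omega>]])

lemma form_deriv_closed:
  assumes \<omega>: "bilinear_form_field A \<omega>" "closed_2_form A \<omega>" and skew: "\<And>u v. \<omega> p u v = - \<omega> p v u"
  shows "form_deriv A \<omega> p u v w - form_deriv A \<omega> p v u w + form_deriv A \<omega> p w u v = 0"
proof -
  obtain X where X: "vector_field A X" "X p = u" by (rule vector_field_through)
  obtain Y where Y: "vector_field A Y" "Y p = v" by (rule vector_field_through)
  obtain Z where Z: "vector_field A Z" "Z p = w" by (rule vector_field_through)
  show ?thesis
    using exterior_derivative_eq[OF \<omega>(1) skew X(1) Y(1) Z(1)] \<omega>(2) X Y Z
    by (simp add: closed_2_form_def)
qed

end

section \<open>Submanifolds\<close>

locale submanifold = smooth_manifold A for A :: "('a::t2_space, 'e::euclidean_space) chart set" +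
  fixes N :: "'a set"
  assumes embedded: "embedded_submanifold A N"
begin

abbreviation TN :: "'a \<Rightarrow> 'e set" where
  "TN \<equiv> tangent_space A N"

definition slice_chart :: "('a, 'e) chart \<Rightarrow> 'e set \<Rightarrow> bool" where
  "slice_chart d S \<longleftrightarrow> d \<in> A \<and> subspace S \<and> snd d ` (fst d \<inter> N) = snd d ` fst d \<inter> S"

lemma slice_chart_exists:
  assumes "x \<in> N"
  obtains d S where "slice_chart d S" "x \<in> fst d"
  using embedded assms unfolding embedded_submanifold_def slice_chart_def by blast

lemma slice_chart_iff:
  assumes "slice_chart d S" "q \<in> fst d"
  shows "q \<in> N \<longleftrightarrow> snd d q \<in> S"
proof
  assume "q \<in> N"
  with assms show "snd d q \<in> S"
    unfolding slice_chart_def by blast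
next
  assume "snd d q \<in> S"
  with assms have "snd d q \<in> snd d ` (fst d \<inter> N)"
    unfolding slice_chart_def by blast
  then obtain q' where "q' \<in> fst d" "q' \<in> N" "snd d q = snd d q'"
    by blast
  then show "q \<in> N"
    using assms chart_inv_apply unfolding slice_chart_def by metis
qed

text \<open>Along a curve in \<open>N\<close> with velocity \<open>v\<close> the difference
  quotients of \<open>\<Phi>\<close> lie in \<open>S\<close>, and a subspace of a Euclidean space is
  closed, so their limit lies in \<open>S\<close>. It serves with a slice as \<open>S\<close> for
  tangency, and with \<open>{0}\<close> for identities that hold only along
  \<open>N\<close>.\<close>

lemma derivative_along_submanifold:
  fixes \<Phi> :: "'e \<Rightarrow> 'f::euclidean_space"
  assumes v: "v \<in> TN x" and S: "subspace S" and U: "open U" "x \<in> U"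
    and \<Phi>: "(\<Phi> has_derivative \<Phi>') (at (snd (chart_at A x) x))"
    and in_S: "\<And>q. q \<in> N \<Longrightarrow> q \<in> fst (chart_at A x) \<Longrightarrow> q \<in> U \<Longrightarrow> \<Phi> (snd (chart_at A x) q) \<in> S"
  shows "\<Phi>' v \<in> S"
proof -
  let ?c = "chart_at A x"
  obtain \<gamma> \<epsilon> where \<gamma>: "\<epsilon> > (0::real)" "\<gamma> 0 = x" "\<gamma> ` {-\<epsilon><..<\<epsilon>} \<subseteq> N \<inter> fst ?c"
    and \<gamma>': "((snd ?c \<circ> \<gamma>) has_vector_derivative v) (at 0)"
    using v by (auto simp: tangent_space_def)
  let ?\<sigma> = "snd ?c \<circ> \<gamma>"
  let ?W = "snd ?c ` (fst ?c \<inter> U)"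
  have W: "open ?W" "?\<sigma> 0 \<in> ?W"
    using open_chart_image[OF chart_at(1) U(1)] U(2) chart_at \<gamma>(2) by auto
  have "isCont ?\<sigma> 0"
    using \<gamma>' has_vector_derivative_continuous by blast
  then have "eventually (\<lambda>t. ?\<sigma> t \<in> ?W) (at 0)"
    using W by (metis isCont_def topological_tendstoD)
  moreover have "eventually (\<lambda>t. t \<in> {-\<epsilon><..<\<epsilon>}) (at 0)"
    using \<gamma>(1) by (intro eventually_at_in_open') auto
  ultimately have ev: "eventually (\<lambda>t. \<Phi> (?\<sigma> t) \<in> S) (at 0)"
  proof eventually_elim
    case (elim t)
    then have t: "\<gamma> t \<in> N" "\<gamma> t \<in> fst ?c"
      using \<gamma>(3) by auto
    obtain q where "q \<in> fst ?c" "q \<in> U" "snd ?c (\<gamma> t) = snd ?c q"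
      using elim by auto
    then have "\<gamma> t \<in> U"
      using chart_inv_apply[OF chart_at(1)] t(2) by metis
    with t in_S show ?case
      by simp
  qed
  have "(\<Phi> has_derivative \<Phi>') (at (?\<sigma> 0))"
    using \<Phi> \<gamma>(2) by simp
  from has_derivative_compose[OF \<gamma>'[unfolded has_vector_derivative_def] this]
  have "((\<lambda>t. \<Phi> (?\<sigma> t)) has_derivative (\<lambda>t. t *\<^sub>R \<Phi>' v)) (at 0)"
    using linear_cmul[OF has_derivative_linear[OF \<Phi>]] by simp
  then have "((\<lambda>t. norm (\<Phi> (?\<sigma> t) - \<Phi> (?\<sigma> 0) - t *\<^sub>R \<Phi>' v) / norm t) \<longlongrightarrow> 0) (at 0)"
    unfolding has_derivative_at by simp
  \<comment> \<open>Rewrites the Frechet remainder as the distance between a difference quotient and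
    \<open>\<Phi>' v\<close>.\<close>
  then have "((\<lambda>t. norm ((\<Phi> (?\<sigma> t) - \<Phi> (?\<sigma> 0)) /\<^sub>R t - \<Phi>' v)) \<longlongrightarrow> 0) (at 0)"
  proof (rule Lim_transform_eventually)
    have "norm (w - t *\<^sub>R \<Phi>' v) / norm t = norm (w /\<^sub>R t - \<Phi>' v)" if "t \<noteq> 0" for t :: real and w
    proof -
      have "w /\<^sub>R t - \<Phi>' v = (w - t *\<^sub>R \<Phi>' v) /\<^sub>R t"
        using that by (simp add: scaleR_diff_right)
      then show ?thesis
        by (simp add: divide_inverse mult.commute)
    qed
    then show "\<forall>\<^sub>F t in at 0. norm (\<Phi> (?\<sigma> t) - \<Phi> (?\<sigma> 0) - t *\<^sub>R \<Phi>' v) / norm t =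
        norm ((\<Phi> (?\<sigma> t) - \<Phi> (?\<sigma> 0)) /\<^sub>R t - \<Phi>' v)"
      by (simp add: eventually_at_filter)
  qed
  from LIM_zero_cancel[OF tendsto_norm_zero_cancel[OF this]]
  have lim: "((\<lambda>t. (\<Phi> (?\<sigma> t) - \<Phi> (?\<sigma> 0)) /\<^sub>R t) \<longlongrightarrow> \<Phi>' v) (at 0)" .
  have "0 \<in> {-\<epsilon><..<\<epsilon>}"
    using \<gamma>(1) by simp
  then have "\<gamma> 0 \<in> N"
    using \<gamma>(3) by blast
  then have at_0: "\<Phi> (?\<sigma> 0) \<in> S"
    using in_S[of x] \<gamma>(2) chart_at U(2) by simp
  from ev have "eventually (\<lambda>t. (\<Phi> (?\<sigma> t) - \<Phi> (?\<sigma> 0)) /\<^sub>R t \<in> S) (at 0)"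
    by (rule eventually_mono) (rule subspace_scale[OF S subspace_diff[OF S _ at_0]])
  then show ?thesis
    using Lim_in_closed_set[OF closed_subspace[OF S] _ _ lim] by simp
qed

text \<open>One direction differentiates the slice coordinates along a curve in \<open>N\<close>;
  the other pulls back a straight segment inside the slice. It shows that the set of velocities is a
  linear subspace.\<close>

lemma tangent_space_slice:
  assumes d: "slice_chart d S" and x: "x \<in> N" "x \<in> fst d"
  shows "v \<in> TN x \<longleftrightarrow> comps d x v \<in> S"
proof
  have dA: "d \<in> A" and S: "subspace S"
    using d by (auto simp: slice_chart_def)
  let ?c = "chart_at A x"
  note c = chart_at[of x]
  {
    assume v: "v \<in> TN x"
    show "comps d x v \<in> S"
      unfolding differential_def
    proof (rule derivative_along_submanifold[OF v S open_domain[OF dA] x(2)])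
      show "(snd d \<circ> chart_inv ?c has_derivative frechet_derivative (snd d \<circ> chart_inv ?c) (at (snd ?c x))) (at (snd ?c x))"
        using transition_has_derivative[OF c(1) dA c(2) x(2)] .
      show "(snd d \<circ> chart_inv ?c) (snd ?c q) \<in> S" if "q \<in> N" "q \<in> fst ?c" "q \<in> fst d" for q
        using that c slice_chart_iff[OF d] by simp
    qed
  }
  assume s: "comps d x v \<in> S"
  let ?W = "snd d ` (fst d \<inter> fst ?c)"
  \<comment> \<open>The line in the slice with the required direction; for small \<open>t\<close> it
    stays in the range of both charts, and its pullback by \<open>d\<close> is a curve in
    \<open>N\<close>.\<close>
  define \<rho> where "\<rho> t = snd d x + t *\<^sub>R comps d x v" for t :: real
  have W: "open ?W" "snd d x \<in> ?W"
    using open_chart_image[OF dA open_domain[OF c(1)]] x c by auto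
  have "isCont \<rho> 0"
    unfolding \<rho>_def by (intro continuous_intros)
  moreover have "\<rho> 0 \<in> ?W"
    using W by (simp add: \<rho>_def)
  ultimately have "open (\<rho> -` ?W)" "0 \<in> \<rho> -` ?W"
    using W(1) by (auto intro!: open_vimage continuous_intros simp: \<rho>_def[abs_def])
  then obtain \<epsilon> where \<epsilon>: "\<epsilon> > 0" "ball 0 \<epsilon> \<subseteq> \<rho> -` ?W"
    using openE by blast
  have ball: "ball 0 \<epsilon> = {-\<epsilon><..<\<epsilon>}"
    by (auto simp: dist_real_def)
  define \<gamma> where "\<gamma> t = chart_inv d (\<rho> t)" for t
  have in_W: "\<gamma> t \<in> N \<and> \<gamma> t \<in> fst ?c" if "t \<in> {-\<epsilon><..<\<epsilon>}" for t
  proof -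
    have "\<rho> t \<in> ?W"
      using \<epsilon>(2) that by (auto simp: ball)
    then obtain q where q: "q \<in> fst d" "q \<in> fst ?c" "\<rho> t = snd d q"
      by blast
    have "\<rho> t \<in> S"
      unfolding \<rho>_def using s x d slice_chart_iff[OF d x(2)]
      by (intro subspace_add[OF S] subspace_scale[OF S]) auto
    then show ?thesis
      using q dA slice_chart_iff[OF d q(1)] by (simp add: \<gamma>_def)
  qed
  have eq: "snd ?c \<circ> \<gamma> = (\<lambda>t. (snd ?c \<circ> chart_inv d) (\<rho> t))"
    by (auto simp: \<gamma>_def)
  show "v \<in> TN x"
    unfolding tangent_space_def
  proof (intro CollectI exI conjI)
    show "\<epsilon> > 0" by fact
    show "\<gamma> 0 = x"
      using dA x by (simp add: \<gamma>_def \<rho>_def)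
    show "\<gamma> ` {-\<epsilon><..<\<epsilon>} \<subseteq> N \<inter> fst ?c"
      using in_W by auto
    show "smooth_on {-\<epsilon><..<\<epsilon>} (snd ?c \<circ> \<gamma>)"
      unfolding eq
    proof (rule smooth_on_compose[OF _ W(1) _ transition_smooth[OF dA c(1)]])
      show "smooth_on {-\<epsilon><..<\<epsilon>} \<rho>"
        unfolding \<rho>_def
        by (intro smooth_on_add smooth_on_const smooth_on_bounded_linear bounded_linear_scaleR_left) auto
      show "\<rho> ` {-\<epsilon><..<\<epsilon>} \<subseteq> ?W"
        using \<epsilon>(2) by (auto simp: ball)
    qed auto
    have "(\<rho> has_derivative (\<lambda>t. t *\<^sub>R comps d x v)) (at 0)"
      unfolding \<rho>_def by (auto intro!: derivative_eq_intros)
    moreover have "(snd ?c \<circ> chart_inv d has_derivative frechet_derivative (snd ?c \<circ> chart_inv d) (at (snd d x)))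
        (at (\<rho> 0))"
      using transition_has_derivative[OF dA c(1) x(2) c(2)] by (simp add: \<rho>_def)
    ultimately have "((\<lambda>t. (snd ?c \<circ> chart_inv d) (\<rho> t)) has_derivative
        (\<lambda>t. frechet_derivative (snd ?c \<circ> chart_inv d) (at (snd d x)) (t *\<^sub>R comps d x v))) (at 0)"
      by (rule has_derivative_compose)
    moreover have "frechet_derivative (snd ?c \<circ> chart_inv d) (at (snd d x)) (t *\<^sub>R comps d x v) = t *\<^sub>R v" for t
      using transition_comps[OF dA x(2) c, of v] linear_cmul[OF linear_transition_derivative[OF dA c(1) x(2) c(2)]]
      by simp
    ultimately show "((snd ?c \<circ> \<gamma>) has_vector_derivative v) (at 0)"
      unfolding eq has_vector_derivative_def by simp
  qed
qed

lemma tangent_subspace: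
  assumes "x \<in> N"
  shows "subspace (TN x)"
proof -
  obtain d S where d: "slice_chart d S" "x \<in> fst d"
    using slice_chart_exists[OF assms] by blast
  have "TN x = {v. comps d x v \<in> S}"
    using tangent_space_slice[OF d(1) assms d(2)] by blast
  moreover have "linear (comps d x)"
    using d by (intro linear_comps) (auto simp: slice_chart_def)
  ultimately show ?thesis
    using d(1) linear_subspace_vimage[of "comps d x" S] by (simp add: slice_chart_def vimage_def)
qed

text \<open>In a slice chart the field with constant components in \<open>S\<close> is tangent at
  all points of \<open>N\<close>, and multiplying by the cutoff preserves this, zero being tangent
  everywhere.\<close>

lemma tangent_extension:
  assumes x: "x \<in> N" and v: "v \<in> TN x"
  obtains Y where "vector_field A Y" "\<And>q. q \<in> N \<Longrightarrow> Y q \<in> TN q" "Y x = v"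
proof -
  obtain d S where d: "slice_chart d S" "x \<in> fst d"
    using slice_chart_exists[OF x] by blast
  then have dA: "d \<in> A" and S: "subspace S"
    by (auto simp: slice_chart_def)
  obtain \<beta> where \<beta>: "\<beta> (snd d x) = 1"
    "\<And>F. smooth_on (snd d ` fst d) F \<Longrightarrow>
      vector_field A (\<lambda>p. if p \<in> fst d then \<beta> (snd d p) *\<^sub>R vec d p (F (snd d p)) else 0)"
    using vector_field_cutoff[OF dA d(2)] by blast
  let ?Y = "\<lambda>p. if p \<in> fst d then \<beta> (snd d p) *\<^sub>R vec d p (comps d x v) else 0"
  show thesis
  proof (rule that[of ?Y])
    show "vector_field A ?Y"
      by (rule \<beta>(2)[OF smooth_on_const])
    show "?Y q \<in> TN q" if "q \<in> N" for q
    proof (cases "q \<in> fst d")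
      case True
      have "vec d q (comps d x v) \<in> TN q"
        using tangent_space_slice[OF d(1) that True] tangent_space_slice[OF d(1) x d(2)] v dA True by simp
      then show ?thesis
        using True by (simp add: subspace_scale[OF tangent_subspace[OF that]])
    next
      case False
      then show ?thesis
        by (simp add: subspace_0[OF tangent_subspace[OF that]])
    qed
    show "?Y x = v"
      using \<beta>(1) dA d(2) by simp
  qed
qed

text \<open>The derivative of \<open>y \<mapsto> D\<phi>(y) Z(y)\<close> along \<open>Y\<close>, for a slice chart \<open>\<phi>\<close>, lies in the slice;
  symmetry of \<open>D\<^sup>2\<phi>\<close> removes the second-order term after antisymmetrization.\<close>

lemma bracket_tangent:
  assumes x: "x \<in> N" and Y: "vector_field A Y" "\<And>q. q \<in> N \<Longrightarrow> Y q \<in> TN q"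
    and Z: "vector_field A Z" "\<And>q. q \<in> N \<Longrightarrow> Z q \<in> TN q"
  shows "lie_bracket A Y Z x \<in> TN x"
proof -
  obtain d S where d: "slice_chart d S" "x \<in> fst d"
    using slice_chart_exists[OF x] by blast
  then have dA: "d \<in> A" and S: "subspace S"
    by (auto simp: slice_chart_def)
  let ?c = "chart_at A x"
  note c = chart_at[of x]
  let ?y = "snd ?c x"
  let ?\<phi> = "snd d \<circ> chart_inv ?c"
  let ?W = "snd ?c ` (fst ?c \<inter> fst d)"
  let ?D = "\<lambda>y. frechet_derivative ?\<phi> (at y)"
  have W: "open ?W" "?y \<in> ?W"
    using open_chart_image[OF c(1) open_domain[OF dA]] c d by auto
  have \<phi>: "smooth_on ?W ?\<phi>"
    by (rule transition_smooth[OF c(1) dA])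
  have *: "frechet_derivative (\<lambda>y. ?D y (Z x)) (at ?y) (Y x) + comps d x (vf_deriv A Z x (Y x)) \<in> S"
    if Y: "\<And>q. q \<in> N \<Longrightarrow> Y q \<in> TN q" and Z: "vector_field A Z" "\<And>q. q \<in> N \<Longrightarrow> Z q \<in> TN q" for Y Z
  proof -
    have "((\<lambda>y. ?D y (vf_coords A ?c Z y)) has_derivative
      (\<lambda>h. frechet_derivative (\<lambda>y. ?D y (vf_coords A ?c Z ?y)) (at ?y) h + ?D ?y (vf_deriv A Z x h))) (at ?y)"
    proof (rule has_derivative_linear_family[OF W _ _ vf_has_derivative[OF Z(1)]])
      show "linear (?D y)" if "y \<in> ?W" for y
        using that linear_transition_derivative[OF c(1) dA] by auto
      show "(\<lambda>y. ?D y u) differentiable (at ?y)" for u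
        using smooth_on_differentiable[OF smooth_on_frechet_derivative[OF \<phi>] W(2)] .
    qed
    moreover have "?D (snd ?c q) (vf_coords A ?c Z (snd ?c q)) \<in> S"
      if "q \<in> N" "q \<in> fst ?c" "q \<in> fst d" for q
      using tangent_space_slice[OF d(1) that(1,3)] Z(2)[OF that(1)]
      by (simp add: vf_coords_apply[OF c(1) that(2)] transition_comps[OF c(1) that(2) dA that(3)])
    ultimately have "frechet_derivative (\<lambda>y. ?D y (vf_coords A ?c Z ?y)) (at ?y) (Y x) + ?D ?y (vf_deriv A Z x (Y x)) \<in> S"
      using derivative_along_submanifold[OF Y[OF x] S open_domain[OF dA] d(2)] by blast
    then show ?thesis
      by (simp add: differential_def)
  qed
  have "comps d x (lie_bracket A Y Z x) \<in> S"
    using subspace_diff[OF S *[OF Y(2) Z] *[OF Z(2) Y]]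
      symmetric_second_derivative[OF W(1) \<phi> W(2), of "Z x" "Y x"]
      linear_diff[OF linear_comps[OF dA d(2)]]
    by (simp add: lie_bracket_eq)
  then show ?thesis
    using tangent_space_slice[OF d(1) x d(2)] by blast
qed

end

section \<open>Submanifolds of Riemannian manifolds\<close>

locale riemannian_submanifold = submanifold A N for A :: "('a::t2_space, 'e::euclidean_space) chart set" and N +
  fixes g :: "'a \<Rightarrow> 'e \<Rightarrow> 'e \<Rightarrow> real"
  assumes metric: "riemannian_metric A g"
begin

abbreviation \<nu>N :: "'a \<Rightarrow> 'e set" where
  "\<nu>N \<equiv> normal_bundle A g N"

lemma metric_form: "bilinear_form_field A g"
  and metric_sym: "g p u v = g p v u"
  and metric_pos: "u \<noteq> 0 \<Longrightarrow> g p u u > 0"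
  using metric by (auto simp: riemannian_metric_def)

lemmas metric_bilinear = form_bilinear[OF metric_form]

lemma metric_eq_0: "g p u u = 0 \<Longrightarrow> u = 0"
  using metric_pos[of u p] by auto

section \<open>Orthogonal splitting of the tangent spaces along the submanifold\<close>

lemma orthogonal_decomposition:
  assumes "subspace T"
  obtains w where "v - w \<in> T" "\<And>t. t \<in> T \<Longrightarrow> g p w t = 0"
proof -
  obtain B where B: "independent B" "span B = T" "finite B"
    using assms basis_exists[of T] independent_imp_finite span_eq_iff
    by (metis span_subspace)
  \<comment> \<open>Smooth orthogonalization of a family that does not depend on its parameter; the
    parameter value \<open>0\<close> used below is arbitrary.\<close>
  have "\<exists>F :: 'e \<Rightarrow> 'e. smooth_on UNIV F \<and>
      (\<forall>y\<in>UNIV. F y - v \<in> span B \<and> (\<forall>b\<in>span B. g p (F y) b = 0))"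
    by (rule smooth_orthogonalization[of UNIV "\<lambda>y::'e. g p" B "\<lambda>y. v"])
      (use B metric_bilinear metric_sym metric_pos smooth_on_const in auto)
  then obtain F :: "'e \<Rightarrow> 'e" where F: "F 0 - v \<in> T" "\<And>t. t \<in> T \<Longrightarrow> g p (F 0) t = 0"
    unfolding B(2) by blast
  then have "v - F 0 \<in> T"
    using subspace_neg[OF assms F(1)] by simp
  then show thesis
    using that F(2) by blast
qed

lemma normal_orthogonal: "n \<in> \<nu>N x \<Longrightarrow> t \<in> TN x \<Longrightarrow> g x n t = 0"
  by (simp add: normal_bundle_def)

text \<open>The double orthogonal complement: if \<open>v\<close> is orthogonal to all normal
  vectors, then its own normal component \<open>w\<close> satisfies
  \<open>g(w, w) = g(v, w) = 0\<close>.\<close>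

lemma tangent_iff_orthogonal:
  assumes "x \<in> N"
  shows "v \<in> TN x \<longleftrightarrow> (\<forall>n\<in>\<nu>N x. g x v n = 0)"
proof
  assume "v \<in> TN x"
  then show "\<forall>n\<in>\<nu>N x. g x v n = 0"
    using normal_orthogonal metric_sym by metis
next
  assume v: "\<forall>n\<in>\<nu>N x. g x v n = 0"
  obtain w where w: "v - w \<in> TN x" "\<And>t. t \<in> TN x \<Longrightarrow> g x w t = 0"
    using orthogonal_decomposition[OF tangent_subspace[OF assms]] by blast
  then have "g x v w = 0" "g x w (v - w) = 0"
    using v by (auto simp: normal_bundle_def)
  then have "g x w w = 0"
    using metric_sym[of x v w] by (simp add: bilinear_rsub[OF metric_bilinear])
  then have "w = 0"
    by (rule metric_eq_0)
  with w(1) show "v \<in> TN x"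
    by simp
qed

text \<open>The definite description in \<open>normal_part\<close> is resolved here: the difference
  of two candidates is both tangent and normal, hence zero.\<close>

lemma normal_part_eq_0_iff:
  assumes "x \<in> N"
  shows "normal_part A g N x v = 0 \<longleftrightarrow> v \<in> TN x"
proof -
  let ?P = "\<lambda>w. w \<in> \<nu>N x \<and> v - w \<in> TN x"
  note T = tangent_subspace[OF assms]
  obtain w where "v - w \<in> TN x" "\<And>t. t \<in> TN x \<Longrightarrow> g x w t = 0"
    using orthogonal_decomposition[OF T] by blast
  then have w: "?P w"
    by (simp add: normal_bundle_def)
  have unique: "w' = w" if "?P w'" for w'
  proof -
    have "w' - w \<in> TN x"
      using subspace_diff[OF T conjunct2[OF w] conjunct2[OF that]] by simp
    then have "g x w' (w' - w) = 0" "g x w (w' - w) = 0"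
      using that w normal_orthogonal by blast+
    then have "g x (w' - w) (w' - w) = 0"
      by (simp add: bilinear_lsub[OF metric_bilinear])
    then show ?thesis
      using metric_eq_0 by fastforce
  qed
  have "normal_part A g N x v = w"
    unfolding normal_part_def by (rule the_equality[of ?P, OF w unique])
  moreover have "w = 0 \<longleftrightarrow> v \<in> TN x"
  proof
    assume "v \<in> TN x"
    then have "?P 0"
      by (simp add: normal_bundle_def bilinear_lzero[OF metric_bilinear])
    then show "w = 0"
      using unique by metis
  qed (use w in simp)
  ultimately show ?thesis
    by simp
qed

text \<open>The parameter \<open>\<phi>\<close> makes it possible to compare a field vanishing at \<open>x\<close> with one whose value there is \<open>n\<close>.\<close>

lemma normal_extension_family:
  assumes d: "slice_chart d S" and x: "x \<in> N" "x \<in> fst d" and n: "n \<in> \<nu>N x"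
  obtains P :: "('e \<Rightarrow> real) \<Rightarrow> 'a \<Rightarrow> 'e"
  where "\<And>\<phi>. smooth_on (snd d ` fst d) \<phi> \<Longrightarrow> vector_field A (P \<phi>)"
    "\<And>\<phi> q. q \<in> N \<Longrightarrow> P \<phi> q \<in> \<nu>N q"
    "\<And>\<phi> q. q \<in> fst d \<Longrightarrow> P \<phi> q = \<phi> (snd d q) *\<^sub>R P (\<lambda>_. 1) q"
    "P (\<lambda>_. 1) x = n"
proof -
  have dA: "d \<in> A" and S: "subspace S"
    using d by (auto simp: slice_chart_def)
  let ?V = "snd d ` fst d"
  let ?G = "form_coords A d g"
  obtain B where B: "independent B" "span B = S" "finite B"
    using S basis_exists[of S] independent_imp_finite span_eq_iff
    by (metis span_subspace)
  have lin: "linear (vec d q)" if "q \<in> fst d" for q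
    using linear_vec[OF dA that] .
  \<comment> \<open>Starts from the constant components of \<open>n\<close> and corrects them within
    the slice directions, making them orthogonal to \<open>S\<close> for the metric at each point of
    the chart.\<close>
  have "\<exists>F. smooth_on ?V F \<and>
      (\<forall>y\<in>?V. F y - comps d x n \<in> span B \<and> (\<forall>b\<in>span B. ?G y (F y) b = 0))"
  proof (rule smooth_orthogonalization[OF open_range[OF dA]])
    show "bilinear (?G y)" if "y \<in> ?V" for y
      using bilinear_form_coords[OF metric_form dA that] .
    show "?G y u v = ?G y v u" for y u v
      by (simp add: form_coords_def metric_sym)
    show "?G y u u > 0" if y: "y \<in> ?V" and u: "u \<noteq> 0" for y u
    proof -
      from y obtain q where q: "q \<in> fst d" "y = snd d q"
        by blast
      have "vec d q u \<noteq> 0"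
        using u comps_vec[OF dA q(1), of u] linear_0[OF linear_comps[OF dA q(1)]] by auto
      then show ?thesis
        using metric_pos dA q by (simp add: form_coords_def)
    qed
    show "smooth_on ?V (\<lambda>y. ?G y u v)" for u v
      using form_smooth[OF metric_form dA] .
  qed (use B smooth_on_const in auto)
  then obtain F where F: "smooth_on ?V F" "\<And>y. y \<in> ?V \<Longrightarrow> F y - comps d x n \<in> S"
    "\<And>y s. y \<in> ?V \<Longrightarrow> s \<in> S \<Longrightarrow> ?G y (F y) s = 0"
    unfolding B(2) by blast
  have normal: "vec d q (F (snd d q)) \<in> \<nu>N q" if q: "q \<in> N" "q \<in> fst d" for q
    unfolding normal_bundle_def
  proof safe
    fix t assume "t \<in> TN q"
    then have "?G (snd d q) (F (snd d q)) (comps d q t) = 0"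
      using F(3) tangent_space_slice[OF d q] q(2) by blast
    then show "g q (vec d q (F (snd d q))) t = 0"
      using form_coords_apply[OF dA q(2), of g "vec d q (F (snd d q))" t] dA q(2) by simp
  qed
  \<comment> \<open>No correction occurs at \<open>x\<close>: it would be tangent, and also normal
    as a difference of two normal vectors.\<close>
  have at_x: "vec d x (F (snd d x)) = n"
  proof -
    let ?w = "vec d x (F (snd d x))"
    have "comps d x (?w - n) \<in> S"
      using F(2)[of "snd d x"] dA x(2) by (simp add: linear_diff[OF linear_comps])
    then have t: "?w - n \<in> TN x"
      using tangent_space_slice[OF d x] by blast
    have "g x (?w - n) (?w - n) = 0"
      using normal_orthogonal[OF normal[OF x] t] normal_orthogonal[OF n t]
      by (simp add: bilinear_lsub[OF metric_bilinear])
    then show ?thesis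
      using metric_eq_0 by fastforce
  qed
  obtain \<beta> where \<beta>: "\<beta> (snd d x) = 1"
    "\<And>F. smooth_on ?V F \<Longrightarrow>
      vector_field A (\<lambda>p. if p \<in> fst d then \<beta> (snd d p) *\<^sub>R vec d p (F (snd d p)) else 0)"
    using vector_field_cutoff[OF dA x(2)] by blast
  define P where "P \<phi> p = (if p \<in> fst d then \<beta> (snd d p) *\<^sub>R vec d p (\<phi> (snd d p) *\<^sub>R F (snd d p)) else 0)"
    for \<phi> p
  have P: "P \<phi> q = \<phi> (snd d q) *\<^sub>R \<beta> (snd d q) *\<^sub>R vec d q (F (snd d q))" if "q \<in> fst d" for \<phi> q
    using that by (simp add: P_def linear_cmul[OF lin])
  show thesis
  proof (rule that[of P])
    show "vector_field A (P \<phi>)" if "smooth_on ?V \<phi>" for \<phi>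
      unfolding P_def[abs_def] by (rule \<beta>(2)[OF smooth_on_scaleR[OF open_range[OF dA] that F(1)]])
    show "P \<phi> q \<in> \<nu>N q" if "q \<in> N" for \<phi> q
    proof (cases "q \<in> fst d")
      case True
      then show ?thesis
        using normal[OF that True] by (simp add: P normal_bundle_def bilinear_lmul[OF metric_bilinear])
    next
      case False
      then show ?thesis
        by (simp add: P_def normal_bundle_def bilinear_lzero[OF metric_bilinear])
    qed
    show "P \<phi> q = \<phi> (snd d q) *\<^sub>R P (\<lambda>_. 1) q" if "q \<in> fst d" for \<phi> q
      using that by (simp add: P)
    show "P (\<lambda>_. 1) x = n"
      using x \<beta>(1) at_x by (simp add: P)
  qed
qed

lemma normal_extension:
  assumes x: "x \<in> N" and n: "n \<in> \<nu>N x"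
  obtains X where "vector_field A X" "\<And>q. q \<in> N \<Longrightarrow> X q \<in> \<nu>N q" "X x = n"
proof -
  obtain d S where d: "slice_chart d S" "x \<in> fst d"
    using slice_chart_exists[OF x] by blast
  obtain P :: "('e \<Rightarrow> real) \<Rightarrow> 'a \<Rightarrow> 'e"
    where "\<And>\<phi>. smooth_on (snd d ` fst d) \<phi> \<Longrightarrow> vector_field A (P \<phi>)"
      "\<And>\<phi> q. q \<in> N \<Longrightarrow> P \<phi> q \<in> \<nu>N q" "P (\<lambda>_. 1) x = n"
    using normal_extension_family[OF d(1) x d(2) n] by metis
  then show thesis
    using that smooth_on_const by blast
qed

text \<open>Multiplies a normal extension of \<open>n\<close> by a function vanishing at
  \<open>x\<close>. In the Leibniz rule only the differential of that function times
  \<open>n\<close> survives at \<open>x\<close>.\<close>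

lemma normal_field_vanishing_at:
  assumes x: "x \<in> N" and n: "n \<in> \<nu>N x" and w: "w \<noteq> 0"
  obtains X \<alpha> where "vector_field A X" "\<And>q. q \<in> N \<Longrightarrow> X q \<in> \<nu>N q" "X x = 0"
    "\<And>h. vf_deriv A X x h = \<alpha> h *\<^sub>R n" "\<alpha> w \<noteq> 0"
proof -
  obtain d S where d: "slice_chart d S" "x \<in> fst d"
    using slice_chart_exists[OF x] by blast
  then have dA: "d \<in> A"
    by (simp add: slice_chart_def)
  obtain P :: "('e \<Rightarrow> real) \<Rightarrow> 'a \<Rightarrow> 'e"
    where P: "\<And>\<phi>. smooth_on (snd d ` fst d) \<phi> \<Longrightarrow> vector_field A (P \<phi>)"
      "\<And>\<phi> q. q \<in> N \<Longrightarrow> P \<phi> q \<in> \<nu>N q"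
      "\<And>\<phi> q. q \<in> fst d \<Longrightarrow> P \<phi> q = \<phi> (snd d q) *\<^sub>R P (\<lambda>_. 1) q"
      "P (\<lambda>_. 1) x = n"
    using normal_extension_family[OF d(1) x d(2) n] by metis
  let ?c = "chart_at A x"
  note c = chart_at[of x]
  let ?y = "snd ?c x"
  let ?\<tau> = "snd d \<circ> chart_inv ?c"
  let ?W = "snd ?c ` (fst ?c \<inter> fst d)"
  \<comment> \<open>With this linear function, \<open>\<alpha> w\<close> becomes
    \<open>e \<bullet> e\<close>, which is nonzero because \<open>w\<close> is.\<close>
  define e where "e = comps d x w"
  define \<phi> where "\<phi> y = (y - snd d x) \<bullet> e" for y
  define \<alpha> where "\<alpha> h = comps d x h \<bullet> e" for h
  have W: "open ?W" "?y \<in> ?W"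
    using open_chart_image[OF c(1) open_domain[OF dA]] c d by auto
  have "smooth_on (snd d ` fst d) \<phi>"
    unfolding \<phi>_def[abs_def]
    by (intro smooth_on_inner smooth_on_diff smooth_on_const open_range[OF dA]
        smooth_on_bounded_linear bounded_linear_ident)
  then have X: "vector_field A (P \<phi>)" and X1: "vector_field A (P (\<lambda>_. 1))"
    using P(1) smooth_on_const by blast+
  have "?\<tau> ?y = snd d x"
    using c by simp
  have \<tau>: "(?\<tau> has_derivative comps d x) (at ?y)"
    using transition_has_derivative[OF c(1) dA c(2) d(2)] by (simp add: differential_def)
  have "((\<lambda>y. \<phi> (?\<tau> y)) has_derivative \<alpha>) (at ?y)"
    unfolding \<phi>_def \<alpha>_def o_apply using \<tau>[unfolded o_def] by (auto intro!: derivative_eq_intros)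
  from has_derivative_scaleR[OF this vf_has_derivative[OF X1]]
  have "((\<lambda>y. \<phi> (?\<tau> y) *\<^sub>R vf_coords A ?c (P (\<lambda>_. 1)) y) has_derivative (\<lambda>h. \<alpha> h *\<^sub>R n)) (at ?y)"
    using c P(4) by (simp add: \<phi>_def)
  then have "(vf_coords A ?c (P \<phi>) has_derivative (\<lambda>h. \<alpha> h *\<^sub>R n)) (at ?y)"
  proof (rule has_derivative_transform_within_open[OF _ W])
    fix y assume "y \<in> ?W"
    then obtain q where q: "q \<in> fst ?c" "q \<in> fst d" "y = snd ?c q"
      by blast
    then show "\<phi> (?\<tau> y) *\<^sub>R vf_coords A ?c (P (\<lambda>_. 1)) y = vf_coords A ?c (P \<phi>) y"
      using P(3)[OF q(2), of \<phi>] linear_cmul[OF linear_comps[OF c(1) q(1)]]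
      by (simp add: vf_coords_apply[OF c(1) q(1)] chart_inv_apply[OF c(1) q(1)])
  qed
  then have "vf_deriv A (P \<phi>) x h = \<alpha> h *\<^sub>R n" for h
    unfolding vf_deriv_def by (simp add: frechet_derivative_eqI)
  moreover have "e \<noteq> 0"
    using w vec_comps[OF dA d(2), of w] linear_0[OF linear_vec[OF dA d(2)]] by (auto simp: e_def)
  then have "\<alpha> w \<noteq> 0"
    by (simp add: \<alpha>_def e_def)
  moreover have "P \<phi> x = 0"
    using P(3)[OF d(2), of \<phi>] by (simp add: \<phi>_def)
  ultimately show thesis
    using that X P(2) by blast
qed

text \<open>The identity is known only on \<open>N\<close>, so it may be differentiated only in
  tangent directions.\<close>

lemma form_deriv_vanishing_along:
  assumes b: "bilinear_form_field A b" and Y: "vector_field A Y" and Z: "vector_field A Z"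
    and zero: "\<And>q. q \<in> N \<Longrightarrow> b q (Y q) (Z q) = 0" and v: "v \<in> TN x"
  shows "form_deriv A b x v (Y x) (Z x) + b x (vf_deriv A Y x v) (Z x) + b x (Y x) (vf_deriv A Z x v) = 0"
proof -
  have "form_deriv A b x v (Y x) (Z x) + b x (vf_deriv A Y x v) (Z x) + b x (Y x) (vf_deriv A Z x v) \<in> {0}"
    by (rule derivative_along_submanifold[OF v subspace_single_0 open_UNIV UNIV_I form_has_derivative[OF b Y Z]])
      (simp add: zero vf_coords_apply form_coords_apply chart_at)
  then show ?thesis
    by simp
qed

section \<open>The Levi-Civita derivative and its normal component\<close>

text \<open>The derivatives of \<open>X\<close> and \<open>Z\<close> cancel between products and
  brackets. What remains is twice the coordinate derivative of \<open>Y\<close> along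
  \<open>X\<close> plus the Christoffel terms, and it depends on \<open>Z\<close> only through
  \<open>Z p\<close>.\<close>

lemma koszul_eq:
  assumes "vector_field A X" "vector_field A Y" "vector_field A Z"
  shows "koszul A g X Y Z p = 2 * g p (vf_deriv A Y p (X p)) (Z p) + form_deriv A g p (X p) (Y p) (Z p)
    + form_deriv A g p (Y p) (X p) (Z p) - form_deriv A g p (Z p) (X p) (Y p)"
  using metric_sym[of p "Y p" "vf_deriv A Z p (X p)"] metric_sym[of p "X p" "vf_deriv A Z p (Y p)"]
    metric_sym[of p "X p" "vf_deriv A Y p (Z p)"]
  by (simp add: koszul_def deriv_along_form[OF metric_form] assms lie_bracket_eq
      bilinear_lsub[OF metric_bilinear])

text \<open>Lowering an index with \<open>g\<close> is injective by positivity, hence surjective in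
  finite dimension.\<close>

lemma riesz_representation:
  assumes "linear f"
  obtains w where "\<And>u. g p w u = f u"
proof -
  define L where "L w = (\<Sum>b\<in>Basis. g p w b *\<^sub>R b)" for w
  have Lb: "L w \<bullet> b = g p w b" if "b \<in> Basis" for w b
    using that by (simp add: L_def inner_sum_left inner_Basis if_distrib sum.delta cong: if_cong)
  have bil: "linear (g p w)" for w
    using metric_bilinear by (simp add: bilinear_def)
  have "linear L"
    unfolding L_def
    by (rule linearI) (simp_all add: bilinear_ladd[OF metric_bilinear] bilinear_lmul[OF metric_bilinear]
        scaleR_add_left sum.distrib scaleR_sum_right)
  moreover have "inj L"
  proof (rule linear_injective_0[OF \<open>linear L\<close>, THEN iffD2], safe)
    fix w assume "L w = 0"
    then have "g p w b = 0" if "b \<in> Basis" for b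
      using Lb[OF that, of w] \<open>L w = 0\<close> by simp
    then have "g p w w = 0"
      using linear_euclidean_expand[OF bil, of w w] by simp
    then show "w = 0"
      by (rule metric_eq_0)
  qed
  ultimately have "surj L"
    by (rule linear_injective_imp_surjective) simp
  then obtain w where "(\<Sum>b\<in>Basis. f b *\<^sub>R b) = L w"
    by (metis surjD)
  then have "g p w b = f b" if "b \<in> Basis" for b
    using Lb[OF that, of w] inner_sum_left_Basis[OF that, of f] by simp
  then have "g p w u = f u" for u
    using linear_euclidean_expand[OF bil, of w u] linear_euclidean_expand[OF assms, of u] by simp
  then show thesis
    using that by blast
qed

text \<open>Shows that the definite description in \<open>levi_civita\<close> denotes: half the
  Koszul expression is a linear functional \<open>f\<close> of \<open>Z p\<close>, so it is
  represented by a vector, and testing with a field of value \<open>w' - w\<close> at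
  \<open>p\<close> gives uniqueness.\<close>

lemma levi_civita_koszul:
  assumes X: "vector_field A X" and Y: "vector_field A Y" and Z: "vector_field A Z"
  shows "2 * g p (levi_civita A g X Y p) (Z p) = koszul A g X Y Z p"
proof -
  define f where "f u = g p (vf_deriv A Y p (X p)) u + (form_deriv A g p (X p) (Y p) u
    + form_deriv A g p (Y p) (X p) u - form_deriv A g p u (X p) (Y p)) / 2" for u
  have "linear (\<lambda>u. form_deriv A g p (X p) (Y p) u)" "linear (\<lambda>u. form_deriv A g p (Y p) (X p) u)"
    "linear (\<lambda>u. form_deriv A g p u (X p) (Y p))" "linear (\<lambda>u. g p (vf_deriv A Y p (X p)) u)"
    using linear_form_deriv_right[OF metric_form] linear_form_deriv[OF metric_form]
      metric_bilinear by (auto simp: bilinear_def)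
  note lin = this
  have "linear f"
    unfolding f_def
    by (rule linearI) (simp_all add: linear_add[OF lin(1)] linear_add[OF lin(2)] linear_add[OF lin(3)]
        linear_add[OF lin(4)] linear_cmul[OF lin(1)] linear_cmul[OF lin(2)] linear_cmul[OF lin(3)]
        linear_cmul[OF lin(4)] field_simps)
  then obtain w where w: "\<And>u. g p w u = f u"
    using riesz_representation by blast
  have kz: "koszul A g X Y Z p = 2 * f (Z p)" if "vector_field A Z" for Z
    by (simp add: koszul_eq[OF X Y that] f_def)
  have "levi_civita A g X Y p = w"
    unfolding levi_civita_def
  proof (rule the_equality)
    show "\<forall>Z. vector_field A Z \<longrightarrow> 2 * g p w (Z p) = koszul A g X Y Z p"
      by (simp add: w kz)
    fix w' assume w': "\<forall>Z. vector_field A Z \<longrightarrow> 2 * g p w' (Z p) = koszul A g X Y Z p"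
    obtain Z where "vector_field A Z" "Z p = w' - w"
      by (rule vector_field_through)
    then have "g p w' (w' - w) = g p w (w' - w)"
      using w' w kz by (metis mult_cancel_left zero_neq_numeral)
    then have "g p (w' - w) (w' - w) = 0"
      by (simp add: bilinear_lsub[OF metric_bilinear])
    then show "w' = w"
      using metric_eq_0 by fastforce
  qed
  then show ?thesis
    by (simp add: w kz[OF Z])
qed

text \<open>The coordinate expression of \<open>(L\<^sub>X g)(u, v)\<close> at \<open>p\<close>.\<close>

definition metric_lie :: "('a \<Rightarrow> 'e) \<Rightarrow> 'a \<Rightarrow> 'e \<Rightarrow> 'e \<Rightarrow> real" where
  "metric_lie X p u v =
     form_deriv A g p (X p) u v + g p (vf_deriv A X p u) v + g p u (vf_deriv A X p v)"

text \<open>Facts \<open>1\<close> and \<open>2\<close> trade the derivatives of \<open>g\<close> in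
  the Koszul expression for derivatives of \<open>X\<close>. Tangency of the bracket makes the
  derivatives of \<open>Y\<close> and \<open>Z\<close> have equal pairings with \<open>X x\<close>,
  so these cancel. Since \<open>X x\<close> is normal, the left side sees only the second
  fundamental form.\<close>

lemma second_fundamental_form_metric_lie:
  assumes x: "x \<in> N" and Y: "vector_field A Y" "\<And>q. q \<in> N \<Longrightarrow> Y q \<in> TN q"
    and Z: "vector_field A Z" "\<And>q. q \<in> N \<Longrightarrow> Z q \<in> TN q"
    and X: "vector_field A X" "\<And>q. q \<in> N \<Longrightarrow> X q \<in> \<nu>N q"
  shows "2 * g x (levi_civita A g Y Z x) (X x) = - metric_lie X x (Y x) (Z x)"
proof -
  have zero: "g q (Z q) (X q) = 0" "g q (Y q) (X q) = 0" if "q \<in> N" for q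
    using Y(2) Z(2) X(2) that tangent_iff_orthogonal by blast+
  note 1 = form_deriv_vanishing_along[OF metric_form Z(1) X(1) zero(1) Y(2)[OF x]]
  note 2 = form_deriv_vanishing_along[OF metric_form Y(1) X(1) zero(2) Z(2)[OF x]]
  have "g x (lie_bracket A Y Z x) (X x) = 0"
    using bracket_tangent[OF x Y Z] tangent_iff_orthogonal[OF x] X(2)[OF x] by blast
  then have "g x (vf_deriv A Z x (Y x)) (X x) = g x (vf_deriv A Y x (Z x)) (X x)"
    by (simp add: lie_bracket_eq bilinear_lsub[OF metric_bilinear])
  with 1 2 show ?thesis
    using metric_sym[of x "Z x" "vf_deriv A X x (Y x)"]
    by (simp add: levi_civita_koszul[OF Y(1) Z(1) X(1)] koszul_eq[OF Y(1) Z(1) X(1)] metric_lie_def)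
qed

end


section \<open>Submanifolds of almost Kaehler manifolds\<close>

locale almost_kahler_submanifold = submanifold A N for A :: "('a::t2_space, 'e::euclidean_space) chart set" and N +
  fixes J :: "'a \<Rightarrow> 'e \<Rightarrow> 'e" and g :: "'a \<Rightarrow> 'e \<Rightarrow> 'e \<Rightarrow> real"
  assumes kahler: "almost_kahler A J g"
begin

sublocale riemannian_submanifold A N g
  by unfold_locales (use kahler in \<open>simp add: almost_kahler_def almost_hermitian_def\<close>)

abbreviation \<Omega> :: "'a \<Rightarrow> 'e \<Rightarrow> 'e \<Rightarrow> real" where
  "\<Omega> \<equiv> kahler_form J g"

section \<open>The Kaehler form and its first derivatives\<close>

lemma J_field: "endomorphism_field A J"
  and J_square: "J p (J p v) = - v"
  and J_skew: "g p (J p u) v = - g p u (J p v)"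
  and \<Omega>_closed: "closed_2_form A \<Omega>"
  using kahler by (auto simp: almost_kahler_def almost_hermitian_def almost_complex_structure_def)

lemmas J_linear = endo_linear[OF J_field]

lemma \<Omega>_skew: "\<Omega> p u v = - \<Omega> p v u"
  using metric_sym[of p "J p v" u] J_skew[of p u v] by (simp add: kahler_form_def)

lemma \<Omega>_coords:
  assumes "c \<in> A" "y \<in> snd c ` fst c"
  shows "form_coords A c \<Omega> y u v = form_coords A c g y (endo_coords A c J y u) v"
  using assms by (auto simp: form_coords_def endo_coords_def kahler_form_def)

lemma \<Omega>_form: "bilinear_form_field A \<Omega>"
  unfolding bilinear_form_field_def
proof (intro conjI allI ballI)
  have lin: "linear (\<lambda>u. g p u v)" "linear (g p u)" for p u v
    using metric_bilinear by (auto simp: bilinear_def)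
  show "bilinear (\<Omega> p)" for p
    unfolding bilinear_def kahler_form_def
    using lin linear_compose[OF J_linear lin(1), unfolded o_def] by simp
  fix c u v assume c: "c \<in> A"
  have "smooth_on (snd c ` fst c) (\<lambda>y. form_coords A c g y (endo_coords A c J y u) v)"
    by (rule smooth_on_bilinear_family[OF open_range[OF c] bilinear_form_coords[OF metric_form c]
          form_smooth[OF metric_form c] endo_smooth[OF J_field c] smooth_on_const])
  then have "smooth_on (snd c ` fst c) (\<lambda>y. form_coords A c \<Omega> y u v)"
    by (rule smooth_on_cong[OF open_range[OF c]]) (rule \<Omega>_coords[OF c])
  then show "smooth_on (snd c ` fst c) (\<lambda>y. let p = chart_inv c y in \<Omega> p (vec c p u) (vec c p v))"
    by (simp add: form_coords_def Let_def)
qed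

text \<open>Product rule for \<open>g(J u, v)\<close>: this is where the derivative of
  \<open>J\<close> enters identities obtained from closedness of \<open>\<Omega>\<close>.\<close>

lemma \<Omega>_deriv:
  "form_deriv A \<Omega> p h u v = form_deriv A g p h (J p u) v + g p (endo_deriv A J p h u) v"
proof -
  let ?c = "chart_at A p"
  let ?y = "snd ?c p"
  note c = chart_at[of p]
  have p: "?y \<in> snd ?c ` fst ?c"
    using c by blast
  have "((\<lambda>y. form_coords A ?c g y (endo_coords A ?c J y u) v) has_derivative
    (\<lambda>h. frechet_derivative (\<lambda>y. form_coords A ?c g y (endo_coords A ?c J ?y u) v) (at ?y) h
      + form_coords A ?c g ?y (endo_deriv A J p h u) v + form_coords A ?c g ?y (endo_coords A ?c J ?y u) 0)) (at ?y)"
  proof (rule has_derivative_bilinear_family[OF open_range[OF c(1)] p _ _ endo_deriv_has_derivative[OF J_field] has_derivative_const])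
    show "bilinear (form_coords A ?c g y)" if "y \<in> snd ?c ` fst ?c" for y
      using bilinear_form_coords[OF metric_form c(1) that] .
    show "(\<lambda>y. form_coords A ?c g y u v) differentiable at ?y" for u v
      using form_deriv_has_derivative[OF metric_form] unfolding differentiable_def by blast
  qed
  then have "((\<lambda>y. form_coords A ?c g y (endo_coords A ?c J y u) v) has_derivative
    (\<lambda>h. form_deriv A g p h (J p u) v + g p (endo_deriv A J p h u) v)) (at ?y)"
    by (simp add: form_deriv_def bilinear_rzero[OF metric_bilinear])
  then have "((\<lambda>y. form_coords A ?c \<Omega> y u v) has_derivative
    (\<lambda>h. form_deriv A g p h (J p u) v + g p (endo_deriv A J p h u) v)) (at ?y)"
    by (rule has_derivative_transform_within_open[OF _ open_range[OF c(1)] p]) (simp only: \<Omega>_coords[OF c(1)])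
  from frechet_derivative_eqI[OF this] show ?thesis
    by (simp add: form_deriv_def)
qed

text \<open>A skew map preserving a subspace preserves its orthogonal complement; hence
  \<open>\<Omega>(X, _)\<close> vanishes on \<open>TN\<close> for normal \<open>X\<close>.\<close>

lemma J_normal:
  assumes "invariant_submanifold A J N" "x \<in> N" "n \<in> \<nu>N x"
  shows "J x n \<in> \<nu>N x"
proof -
  have "g x (J x n) t = 0" if "t \<in> TN x" for t
    using J_skew[of x n t] normal_orthogonal[OF assms(3), of "J x t"] assms(1,2) that
    by (auto simp: invariant_submanifold_def)
  then show ?thesis
    by (simp add: normal_bundle_def)
qed

text \<open>\<open>L\<^sub>X \<Omega> = d i\<^sub>X \<Omega>\<close> vanishes on \<open>TN\<close>, because \<open>i\<^sub>X \<Omega>\<close> does; so the two terms of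
  \<open>(L\<^sub>X \<Omega>)(u, w) = (L\<^sub>X g)(J u, w) + g ((L\<^sub>X J) u, w)\<close> cancel.\<close>

lemma lie_derivative_metric_lie:
  assumes inv: "invariant_submanifold A J N" and x: "x \<in> N"
    and X: "vector_field A X" "\<And>q. q \<in> N \<Longrightarrow> X q \<in> \<nu>N q"
    and Y: "vector_field A Y" "Y x \<in> TN x" and w: "w \<in> TN x"
  shows "g x (lie_derivative A X J Y x) w = - metric_lie X x (J x (Y x)) w"
proof -
  let ?u = "Y x"
  let ?D = "vf_deriv A X x"
  obtain U where U: "vector_field A U" "\<And>q. q \<in> N \<Longrightarrow> U q \<in> TN q" "U x = ?u"
    using tangent_extension[OF x Y(2)] by blast
  obtain W where W: "vector_field A W" "\<And>q. q \<in> N \<Longrightarrow> W q \<in> TN q" "W x = w"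
    using tangent_extension[OF x w] by blast
  have zero: "\<Omega> q (X q) (V q) = 0" if "q \<in> N" "\<And>q. q \<in> N \<Longrightarrow> V q \<in> TN q" for q V
    using normal_orthogonal[OF J_normal[OF inv that(1) X(2)[OF that(1)]] that(2)[OF that(1)]]
    by (simp add: kahler_form_def)
  \<comment> \<open>\<open>1\<close> and \<open>2\<close> differentiate
    \<open>\<Omega>(X, W) = 0\<close> along \<open>u\<close> and \<open>\<Omega>(X, U) = 0\<close>
    along \<open>w\<close>; \<open>3\<close> is closedness at the three vectors; \<open>4\<close>
    removes the derivatives of the extensions, because \<open>[U, W]\<close> is tangent. Combined
    they amount to Cartan's formula on \<open>TN\<close>.\<close>
  have 1: "form_deriv A \<Omega> x ?u (X x) w + \<Omega> x (?D ?u) w + \<Omega> x (X x) (vf_deriv A W x ?u) = 0"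
    using form_deriv_vanishing_along[OF \<Omega>_form X(1) W(1) zero[OF _ W(2)] Y(2)] W by simp
  have 2: "form_deriv A \<Omega> x w (X x) ?u + \<Omega> x (?D w) ?u + \<Omega> x (X x) (vf_deriv A U x w) = 0"
    using form_deriv_vanishing_along[OF \<Omega>_form X(1) U(1) zero[OF _ U(2)] w] U by simp
  have 3: "form_deriv A \<Omega> x (X x) ?u w - form_deriv A \<Omega> x ?u (X x) w + form_deriv A \<Omega> x w (X x) ?u = 0"
    by (rule form_deriv_closed[OF \<Omega>_form \<Omega>_closed \<Omega>_skew])
  have "lie_bracket A U W x \<in> TN x"
    by (rule bracket_tangent[OF x U(1,2) W(1,2)])
  then have "\<Omega> x (X x) (lie_bracket A U W x) = 0"
    using normal_orthogonal[OF J_normal[OF inv x X(2)[OF x]]] by (simp add: kahler_form_def)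
  then have 4: "\<Omega> x (X x) (vf_deriv A W x ?u) = \<Omega> x (X x) (vf_deriv A U x w)"
    using U(3) W(3) by (simp add: lie_bracket_eq bilinear_rsub[OF form_bilinear[OF \<Omega>_form]])
  \<comment> \<open>The left side is the Lie derivative of \<open>\<Omega>\<close> along
    \<open>X\<close>, evaluated at \<open>?u\<close> and \<open>w\<close>.\<close>
  have "form_deriv A \<Omega> x (X x) ?u w + \<Omega> x (?D ?u) w + \<Omega> x ?u (?D w) = 0"
    using 1 2 3 4 \<Omega>_skew[of x ?u "?D w"] by linarith
  then have "form_deriv A g x (X x) (J x ?u) w + g x (endo_deriv A J x (X x) ?u) w
      + g x (J x (?D ?u)) w + g x (J x ?u) (?D w) = 0"
    by (simp add: \<Omega>_deriv kahler_form_def)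
  then show ?thesis
    unfolding lie_derivative_eq[OF J_field X(1) Y(1)] metric_lie_def
    by (simp add: bilinear_lsub[OF metric_bilinear] bilinear_ladd[OF metric_bilinear])
qed

section \<open>Soldering, invariance and total geodesy\<close>

lemma metric_in_annihilator:
  assumes "w \<in> TN x"
  shows "(\<lambda>v. g x v w) \<in> annihilator (\<nu>N x)"
  using assms metric_bilinear normal_orthogonal by (simp add: annihilator_def bilinear_def)

lemma soldered_orthogonal:
  assumes "soldered A N \<nu>N J" "vector_field A X" "\<And>q. q \<in> N \<Longrightarrow> X q \<in> \<nu>N q" "x \<in> N"
    and "vector_field A Y" "Y x \<in> TN x" "w \<in> TN x"
  shows "g x (lie_derivative A X J Y x) w = 0"
  using assms(1)[unfolded soldered_def, rule_format, of X x Y, OF _ assms(4) _ metric_in_annihilator[OF assms(7)]]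
    assms(2-6) by simp

lemma soldered_imp_invariant:
  assumes sold: "soldered A N \<nu>N J"
  shows "invariant_submanifold A J N"
  unfolding invariant_submanifold_def
proof (intro ballI image_subsetI)
  fix x w assume x: "x \<in> N" and w: "w \<in> TN x"
  have "g x (J x w) n = 0" if n: "n \<in> \<nu>N x" for n
  \<comment> \<open>The field vanishing at \<open>x\<close> can have a nonzero derivative along
    \<open>w\<close> only if \<open>w\<close> is nonzero.\<close>
  proof (cases "w = 0")
    case True
    then show ?thesis
      by (simp add: linear_0[OF J_linear] bilinear_lzero[OF metric_bilinear])
  next
    case False
    obtain X \<alpha> where X: "vector_field A X" "\<And>q. q \<in> N \<Longrightarrow> X q \<in> \<nu>N q" "X x = 0"
      "\<And>h. vf_deriv A X x h = \<alpha> h *\<^sub>R n" "\<alpha> w \<noteq> 0"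
      using normal_field_vanishing_at[OF x n False] by blast
    obtain Y where Y: "vector_field A Y" "Y x = w"
      by (rule vector_field_through)
    have "endo_deriv A J x 0 w = 0"
      using linear_0[OF has_derivative_linear[OF endo_deriv_has_derivative[OF J_field]]] .
    \<comment> \<open>As \<open>X x = 0\<close>, the derivative of \<open>J\<close> drops out and
      only the derivative of \<open>X\<close> contributes. Pairing with the tangent vector
      \<open>w\<close> then removes the multiple of the normal vector \<open>n\<close>.\<close>
    then have lie: "lie_derivative A X J Y x = \<alpha> w *\<^sub>R J x n - \<alpha> (J x w) *\<^sub>R n"
      by (simp add: lie_derivative_eq[OF J_field X(1) Y(1)] X(3,4) Y(2) linear_cmul[OF J_linear])
    have "g x (lie_derivative A X J Y x) w = 0"
      by (rule soldered_orthogonal[OF sold X(1,2) x Y(1)]) (simp_all add: Y(2) w)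
    then have "\<alpha> w * g x (J x n) w = 0"
      using normal_orthogonal[OF n w]
      by (simp add: lie bilinear_lsub[OF metric_bilinear] bilinear_lmul[OF metric_bilinear])
    then have "g x (J x n) w = 0"
      using X(5) by simp
    then show ?thesis
      using J_skew[of x n w] metric_sym[of x n "J x w"] by simp
  qed
  then show "J x w \<in> TN x"
    using tangent_iff_orthogonal[OF x] by blast
qed

lemma soldered_imp_totally_geodesic:
  assumes sold: "soldered A N \<nu>N J"
  shows "totally_geodesic A g N"
  unfolding totally_geodesic_def second_fundamental_form_def
proof (intro allI impI ballI; elim conjE)
  fix Y Z x
  assume Y: "vector_field A Y" and Z: "vector_field A Z" and x: "x \<in> N"
    and tangent: "\<forall>x\<in>N. Y x \<in> TN x \<and> Z x \<in> TN x"
  have inv: "invariant_submanifold A J N"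
    using sold by (rule soldered_imp_invariant)
  \<comment> \<open>Soldering controls the Lie derivative of \<open>g\<close> at \<open>J u\<close>;
    the choice \<open>u = - J (Y x)\<close> makes \<open>J u\<close> equal to \<open>Y x\<close>,
    and invariance makes \<open>u\<close> an admissible tangent vector.\<close>
  have u: "- J x (Y x) \<in> TN x"
    using inv x tangent subspace_neg[OF tangent_subspace[OF x]] by (auto simp: invariant_submanifold_def)
  obtain U where U: "vector_field A U" "U x = - J x (Y x)"
    by (rule vector_field_through)
  have "g x (levi_civita A g Y Z x) n = 0" if n: "n \<in> \<nu>N x" for n
  proof -
    obtain X where X: "vector_field A X" "\<And>q. q \<in> N \<Longrightarrow> X q \<in> \<nu>N q" "X x = n"
      using normal_extension[OF x n] by blast
    have "g x (lie_derivative A X J U x) (Z x) = 0"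
      by (rule soldered_orthogonal[OF sold X(1,2) x U(1)]) (use U(2) u x tangent in auto)
    moreover have "J x (U x) = Y x"
      by (simp add: U(2) linear_neg[OF J_linear] J_square)
    ultimately have "metric_lie X x (Y x) (Z x) = 0"
      using lie_derivative_metric_lie[OF inv x X(1,2) U(1), of "Z x"] u tangent x U(2) by simp
    then show ?thesis
      using second_fundamental_form_metric_lie[OF x Y _ Z _ X(1,2)] tangent X(3) by simp
  qed
  then show "normal_part A g N x (levi_civita A g Y Z x) = 0"
    using normal_part_eq_0_iff[OF x] tangent_iff_orthogonal[OF x] by blast
qed

lemma invariant_totally_geodesic_imp_soldered:
  assumes inv: "invariant_submanifold A J N" and geod: "totally_geodesic A g N"
  shows "soldered A N \<nu>N J"
  unfolding soldered_def
proof (intro allI impI ballI; elim conjE)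
  fix X x Y \<xi>
  assume X: "vector_field A X" "\<forall>x\<in>N. X x \<in> \<nu>N x" and x: "x \<in> N"
    and Y: "vector_field A Y" "Y x \<in> TN x" and \<xi>: "\<xi> \<in> annihilator (\<nu>N x)"
  have X2: "X q \<in> \<nu>N q" if "q \<in> N" for q
    using X(2) that by blast
  have u: "J x (Y x) \<in> TN x"
    using inv x Y(2) by (auto simp: invariant_submanifold_def)
  \<comment> \<open>Total geodesy speaks of fields tangent along all of \<open>N\<close>, so
    \<open>J (Y x)\<close> and later \<open>w\<close> are extended accordingly; \<open>Y\<close>
    itself is tangent only at \<open>x\<close>.\<close>
  obtain U where U: "vector_field A U" "\<And>q. q \<in> N \<Longrightarrow> U q \<in> TN q" "U x = J x (Y x)"
    using tangent_extension[OF x u] by blast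
  have "g x (lie_derivative A X J Y x) w = 0" if w: "w \<in> TN x" for w
  proof -
    obtain W where W: "vector_field A W" "\<And>q. q \<in> N \<Longrightarrow> W q \<in> TN q" "W x = w"
      using tangent_extension[OF x w] by blast
    have "second_fundamental_form A g N U W x = 0"
      using geod[unfolded totally_geodesic_def, rule_format, of U W x] U(1,2) W(1,2) x by simp
    then have "levi_civita A g U W x \<in> TN x"
      using normal_part_eq_0_iff[OF x] by (simp add: second_fundamental_form_def)
    then have "g x (levi_civita A g U W x) (X x) = 0"
      using tangent_iff_orthogonal[OF x] X2[OF x] by blast
    then have "metric_lie X x (J x (Y x)) w = 0"
      using second_fundamental_form_metric_lie[OF x U(1,2) W(1,2) X(1) X2] U(3) W(3) by simp
    then show ?thesis
      using lie_derivative_metric_lie[OF inv x X(1) X2 Y w] by simp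
  qed
  \<comment> \<open>Orthogonality to every tangent vector makes the Lie derivative normal, so every
    covector in the annihilator kills it, not only those of the form \<open>g(_, w)\<close>.\<close>
  then have "lie_derivative A X J Y x \<in> \<nu>N x"
    by (simp add: normal_bundle_def)
  then show "\<xi> (lie_derivative A X J Y x) = 0"
    using \<xi> by (simp add: annihilator_def)
qed

end

theorem proposition3p5:
  fixes A :: "('a::{t2_space, second_countable_topology}, 'e::euclidean_space) chart set"
    and J :: "'a \<Rightarrow> 'e \<Rightarrow> 'e"
    and g :: "'a \<Rightarrow> 'e \<Rightarrow> 'e \<Rightarrow> real"
    and N :: "'a set"
  assumes "smooth_structure A"
    and "almost_kahler A J g"
    and "embedded_submanifold A N"
  shows "soldered A N (normal_bundle A g N) J \<longleftrightarrow>
    invariant_submanifold A J N \<and> totally_geodesic A g N"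
proof -
  interpret almost_kahler_submanifold A N J g
    using assms by unfold_locales
  show ?thesis
    using soldered_imp_invariant soldered_imp_totally_geodesic
      invariant_totally_geodesic_imp_soldered by blast
qed

end
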